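(* Let $a\ge 1$, let $p=(p_1,\dots,p_a)$ be a probability vector with all $p_s>0$, let $n\ge 2$ and $0\le k\le n-1$ be integers, and let $Y_{\geq k, n}^{p}$ denote the number of nodes with at least $k$ descendants in a $p$-biased recursive tree of order $n$. Let $\sigma^2=\mathrm{Var}(Y_{\ge k,n}^p)$ and assume $\sigma>0$. Let $\mathcal{G}$ be a standard normal random variable. Then $$d_W\left( \frac{Y_{\geq k, n}^{p}-\mathbb{E}[Y_{\geq k, n}^{p}]}{\sigma},\ \mathcal{G} \right) \leq \frac{2k+1}{\sigma} \left( (2k+1) + \frac{\sqrt{28}\,(2k+1)^{1/2}}{\sqrt{\pi}} \right).$$
   Context: $d_W$ is the Wasserstein distance between (laws of) real random variables: $d_W(X,Z)=\sup_h|\mathbb{E}h(X)-\mathbb{E}h(Z)|$ over all $1$-Lipschitz $h:\mathbb{R}\to\mathbb{R}$. $p$-biased riffle shuffle of $\{2,\dots,n\}$: start with the deck $2,3,\dots,n$ in increasing order; cut it into $a$ consecutive piles whose sizes $(b_1,\dots,b_a)$ (pile 1 consisting of the $b_1$ smallest cards, etc.) have the multinomial$(n-1;p)$ distribution; then choose uniformly one of the $\binom{n-1}{b_1,\dots,b_a}$ ways of interleaving the piles keeping the cards of each pile in their original order. The resulting arrangement $\gamma=(\gamma(2),\dots,\gamma(n))$ is the $p$-biased riffle shuffle permutation of $\{2,\dots,n\}$, where $\gamma(j)$ is the card in position $j$. $p$-biased recursive tree ($p$-BRT) of order $n$: the random rooted tree on vertices $1,\dots,n$ with root $1$, obtained by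 attaching each node $i\ge 2$ to the rightmost element $j$ of $\gamma$ which precedes $i$ and satisfies $j<i$; if there is no such $j$, the parent of $i$ is $1$. A descendant of a vertex $v$ is any vertex that is a child of $v$ or a descendant of a child of $v$ (so $v$ is not its own descendant). *)

theory Defs
  imports "HOL-Probability.Probability"
begin

section \<open>Wasserstein distance\<close>

text \<open>
  The supremum is taken in the extended reals, so no boundedness of the set is presupposed.
  Both integrals exist whenever \<open>\<mu>\<close> and \<open>\<nu>\<close> have a finite first moment; the Bochner integral
  of a non-integrable function is 0, so the definition is meaningful only for such measures.
\<close>

definition wasserstein :: "real measure \<Rightarrow> real measure \<Rightarrow> ereal" where
  "wasserstein \<mu> \<nu> = (SUP h \<in> {h :: real \<Rightarrow> real. 1-lipschitz_on UNIV h}.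
     ereal \<bar>(\<integral>x. h x \<partial>\<mu>) - (\<integral>x. h x \<partial>\<nu>)\<bar>)"


section \<open>Multinomial distribution\<close>

definition compositions :: "nat \<Rightarrow> nat \<Rightarrow> nat list set" where
  "compositions a m = {b. length b = a \<and> sum_list b = m}"

definition multinomial_weight :: "nat \<Rightarrow> real list \<Rightarrow> nat list \<Rightarrow> real" where
  "multinomial_weight m p b =
     fact m / (\<Prod>s<length p. fact (b ! s)) * (\<Prod>s<length p. (p ! s) ^ (b ! s))"

definition multinomial_pmf :: "nat \<Rightarrow> real list \<Rightarrow> nat list pmf" where
  "multinomial_pmf m p =
     embed_pmf (\<lambda>b. if b \<in> compositions (length p) m then multinomial_weight m p b else 0)"

lemma finite_compositions: "finite (compositions a m)"
proof (rule finite_subset)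
  show "compositions a m \<subseteq> {b. set b \<subseteq> {..m} \<and> length b = a}"
    by (auto simp: compositions_def intro: member_le_sum_list)
qed (simp add: finite_lists_length_eq)

lemma compositions_Suc:
  "compositions (Suc a) m = (\<Union>i\<in>{..m}. (#) i ` compositions a (m - i))"
proof (intro equalityI subsetI)
  fix b assume "b \<in> compositions (Suc a) m"
  then obtain i c where "b = i # c" "length c = a" "i + sum_list c = m"
    by (auto simp: compositions_def length_Suc_conv)
  then have "i \<in> {..m}" "b \<in> (#) i ` compositions a (m - i)"
    by (auto simp: compositions_def)
  then show "b \<in> (\<Union>i\<in>{..m}. (#) i ` compositions a (m - i))" by blast
qed (auto simp: compositions_def)

lemma multinomial_weight_Cons:
  assumes "i \<le> m"
  shows "multinomial_weight m (q # p) (i # c) =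
           real (m choose i) * q ^ i * multinomial_weight (m - i) p c"
  unfolding multinomial_weight_def length_Cons prod.lessThan_Suc_shift
  by (simp add: binomial_fact[OF assms])

lemma sum_multinomial_weight:
  "(\<Sum>b\<in>compositions (length p) m. multinomial_weight m p b) = sum_list p ^ m"
proof (induction p arbitrary: m)
  case Nil
  have "compositions 0 m = (if m = 0 then {[]} else {})"
    by (auto simp: compositions_def)
  then show ?case by (simp add: multinomial_weight_def)
next
  case (Cons q p)
  have "(\<Sum>b\<in>compositions (length (q # p)) m. multinomial_weight m (q # p) b) =
        (\<Sum>i\<le>m. \<Sum>b\<in>(#) i ` compositions (length p) (m - i). multinomial_weight m (q # p) b)"
    unfolding length_Cons compositions_Suc
    by (rule sum.UNION_disjoint) (auto simp: finite_compositions)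
  also have "\<dots> = (\<Sum>i\<le>m. \<Sum>c\<in>compositions (length p) (m - i). multinomial_weight m (q # p) (i # c))"
    by (simp add: sum.reindex)
  also have "\<dots> = (\<Sum>i\<le>m. real (m choose i) * q ^ i * sum_list p ^ (m - i))"
    by (intro sum.cong refl)
       (simp add: multinomial_weight_Cons sum_distrib_left[symmetric] Cons.IH)
  also have "\<dots> = (q + sum_list p) ^ m"
    by (simp add: binomial_ring)
  finally show ?case by simp
qed

lemma pmf_multinomial_pmf:
  assumes "\<forall>x\<in>set p. 0 \<le> x" and "sum_list p = 1"
  shows "pmf (multinomial_pmf m p) b =
           (if b \<in> compositions (length p) m then multinomial_weight m p b else 0)"
  unfolding multinomial_pmf_def
proof (rule pmf_embed_pmf)
  have nonneg: "0 \<le> multinomial_weight m p b" for b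
    unfolding multinomial_weight_def using assms(1)
    by (intro mult_nonneg_nonneg divide_nonneg_nonneg prod_nonneg) auto
  then show "0 \<le> (if b \<in> compositions (length p) m then multinomial_weight m p b else 0)" for b
    by simp
  have "(\<integral>\<^sup>+ b. ennreal (if b \<in> compositions (length p) m then multinomial_weight m p b else 0)
          \<partial>count_space UNIV) =
        (\<Sum>b\<in>compositions (length p) m. ennreal (multinomial_weight m p b))"
    by (subst nn_integral_count_space'[OF finite_compositions[of "length p" m]])
       (auto intro: sum.cong)
  also have "\<dots> = 1"
    using nonneg by (simp add: sum_ennreal sum_multinomial_weight assms(2))
  finally show "(\<integral>\<^sup>+ b. ennreal (if b \<in> compositions (length p) m then multinomial_weight m p b else 0)
          \<partial>count_space UNIV) = 1" .
qed


section \<open>Biased riffle shuffle\<close>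

fun cut_deck :: "nat list \<Rightarrow> 'a list \<Rightarrow> 'a list list" where
  "cut_deck [] deck = []"
| "cut_deck (b # bs) deck = take b deck # cut_deck bs (drop b deck)"

fun interleavings :: "'a list list \<Rightarrow> 'a list set" where
  "interleavings [] = {[]}"
| "interleavings (xs # xss) = (\<Union>ys\<in>interleavings xss. shuffles xs ys)"

lemma finite_interleavings: "finite (interleavings xss)"
  by (induction xss) auto

lemma mset_interleavings: "zs \<in> interleavings xss \<Longrightarrow> mset zs = mset (concat xss)"
  by (induction xss arbitrary: zs) (auto simp: mset_shuffles)

lemma interleavings_nonempty: "interleavings xss \<noteq> {}"
  by (induction xss) (auto intro: splice_in_shuffles)

lemma concat_cut_deck: "sum_list bs = length deck \<Longrightarrow> concat (cut_deck bs deck) = deck"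
  by (induction bs arbitrary: deck) auto

text \<open>
  For a deck of distinct cards the interleavings are counted by the multinomial coefficient, so
  choosing an element of \<open>interleavings\<close> uniformly is the same as choosing a way of interleaving
  uniformly.
\<close>

lemma card_interleavings_cut_deck:
  assumes "distinct deck" "sum_list bs = length deck"
  shows "card (interleavings (cut_deck bs deck)) * (\<Prod>b\<leftarrow>bs. fact b) = (fact (length deck) :: nat)"
  using assms
proof (induction bs arbitrary: deck)
  case (Cons b bs)
  let ?I = "interleavings (cut_deck bs (drop b deck))"
  have b: "b \<le> length deck" and sum: "sum_list bs = length (drop b deck)"
    using Cons.prems by auto
  have set_I: "set ys = set (drop b deck)" and len_I: "length ys = length deck - b"
    if "ys \<in> ?I" for ys
  proof -
    have "mset ys = mset (drop b deck)"
      using mset_interleavings[OF that] concat_cut_deck[OF sum] by simp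
    then show "set ys = set (drop b deck)" "length ys = length deck - b"
      by (auto dest: mset_eq_setD mset_eq_length)
  qed
  have disj: "set (take b deck) \<inter> set (drop b deck) = {}"
    using Cons.prems(1) by (simp add: set_take_disj_set_drop_if_distinct)
  have "card (interleavings (cut_deck (b # bs) deck)) = (\<Sum>ys\<in>?I. card (shuffles (take b deck) ys))"
    unfolding cut_deck.simps interleavings.simps
  proof (rule card_UN_disjoint)
    show "\<forall>ys\<in>?I. \<forall>ys'\<in>?I. ys \<noteq> ys' \<longrightarrow>
            shuffles (take b deck) ys \<inter> shuffles (take b deck) ys' = {}"
    proof (intro ballI impI)
      fix ys ys' assume ys: "ys \<in> ?I" "ys' \<in> ?I" "ys \<noteq> ys'"
      have "filter (\<lambda>x. x \<notin> set (take b deck)) zs = us"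
        if "zs \<in> shuffles (take b deck) us" "us \<in> ?I" for zs us
      proof -
        have "set (take b deck) \<inter> set us = {}"
          unfolding set_I[OF that(2)] by (rule disj)
        then show ?thesis using filter_shuffles_disjoint1(2) that(1) by blast
      qed
      with ys show "shuffles (take b deck) ys \<inter> shuffles (take b deck) ys' = {}"
        by blast
    qed
  qed (auto simp: finite_interleavings)
  also have "\<dots> = (\<Sum>ys\<in>?I. length deck choose b)"
  proof (rule sum.cong)
    fix ys assume ys: "ys \<in> ?I"
    have "set (take b deck) \<inter> set ys = {}"
      unfolding set_I[OF ys] by (rule disj)
    then show "card (shuffles (take b deck) ys) = length deck choose b"
      using card_disjoint_shuffles[of "take b deck" ys] len_I[OF ys] b by simp
  qed simp
  finally have "card (interleavings (cut_deck (b # bs) deck)) = card ?I * (length deck choose b)"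
    by simp
  moreover have "card ?I * (\<Prod>b\<leftarrow>bs. fact b) = (fact (length deck - b) :: nat)"
    using Cons.IH[OF _ sum] Cons.prems(1) by simp
  ultimately show ?case
    using binomial_fact_lemma[OF b] by (simp add: algebra_simps)
qed auto

text \<open>
  The arrangement \<open>\<gamma>\<close> is a list: the card in position \<open>j\<close> (\<open>2 \<le> j \<le> n\<close>) is \<open>\<gamma> ! (j - 2)\<close>.
\<close>

definition riffle_pmf :: "nat \<Rightarrow> real list \<Rightarrow> nat list pmf" where
  "riffle_pmf n p =
     bind_pmf (multinomial_pmf (n - 1) p) (\<lambda>b. pmf_of_set (interleavings (cut_deck b [2..<n + 1])))"


section \<open>Biased recursive trees\<close>

text \<open>
  The list \<open>takeWhile (\<lambda>j. j \<noteq> i) \<gamma>\<close> consists of the elements of \<open>\<gamma>\<close> preceding \<open>i\<close>.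
\<close>

definition brt_parent :: "nat list \<Rightarrow> nat \<Rightarrow> nat" where
  "brt_parent \<gamma> i =
     (let js = filter (\<lambda>j. j < i) (takeWhile (\<lambda>j. j \<noteq> i) \<gamma>)
      in if js = [] then 1 else last js)"

text \<open>
  A rooted tree on \<open>{1..n}\<close> with root 1 is represented by the set of its pairs (parent, child).
\<close>

type_synonym rtree = "(nat \<times> nat) set"

definition brt_of :: "nat \<Rightarrow> nat list \<Rightarrow> rtree" where
  "brt_of n \<gamma> = {(brt_parent \<gamma> i, i) | i. i \<in> {2..n}}"

definition brt_pmf :: "nat \<Rightarrow> real list \<Rightarrow> rtree pmf" where
  "brt_pmf n p = map_pmf (brt_of n) (riffle_pmf n p)"

definition descendants :: "rtree \<Rightarrow> nat \<Rightarrow> nat set" where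
  "descendants T v = {w. (v, w) \<in> T\<^sup>+}"

definition num_ge_descendants :: "nat \<Rightarrow> nat \<Rightarrow> rtree \<Rightarrow> nat" where
  "num_ge_descendants n k T = card {v \<in> {1..n}. k \<le> card (descendants T v)}"

end

theory Submission
  imports Defs
begin

text \<open>
  A riffle shuffle is an inverse sorting: if independent labels with law \<open>p\<close> are attached to the
  \<open>m = n - 1\<close> positions, then the card in a position is determined by ranking the positions by
  label and then by position, and the label of a position is the pile its card comes from.
  Conversely the interleavings of piles of given sizes correspond bijectively to the words of labels
  with the given letter counts (\<open>word_pmf_eq_bind\<close>, \<open>map_riffle_pmf\<close>).  The descendants of the
  vertex in position \<open>j\<close> occupy the maximal run of positions after \<open>j\<close> whose vertices exceed it
  (\<open>descendants_nth\<close>).  Hence, for \<open>k \<ge> 1\<close>, the statistic has the law of \<open>1 + X\<^sub>0 + \<dots> + X\<^sub>N\<^sub>-\<^sub>1\<close>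
  with \<open>N = m - k\<close>, where \<open>X\<^sub>i\<close> indicates that the label at \<open>i\<close> is at most each of the next \<open>k\<close>
  labels.  For \<open>k = 0\<close> it is constant, which contradicts \<open>\<sigma> > 0\<close>.

  It remains to bound the distance to the normal law of a standardised sum \<open>S\<close> of \<open>[0, 1]\<close>-valued
  functions \<open>X\<^sub>i\<close> of \<open>k + 1\<close> consecutive independent variables.  Stein's method for locally dependent
  summands is not applied to the \<open>X\<^sub>i\<close> themselves, because the sum of their variances need not be
  bounded by \<open>\<sigma>\<^sup>2\<close>.  Instead \<open>S - E S\<close> is written as the sum of the martingale differences \<open>\<zeta>\<^sub>j\<close>
  obtained by revealing the variables from the last one to the first one.  They satisfy
  \<open>\<bar>\<zeta>\<^sub>j\<bar> \<le> k + 1\<close>, the difference \<open>\<zeta>\<^sub>j\<close> depends only on the variables \<open>j, \<dots>, j + k\<close>, and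
  \<open>\<zeta>\<^sub>j\<close> is orthogonal to every function that does not depend on the variable \<open>j\<close>.
  In particular \<open>\<Sum> E \<zeta>\<^sub>j\<^sup>2 = \<sigma>\<^sup>2\<close> exactly.

  For a 1-Lipschitz \<open>h\<close> let \<open>f = stein_sol h\<close>, which solves the Stein equation
  \<open>f' w - w f w = h w - E h G\<close>, with \<open>G\<close> standard normal;
  then \<open>\<bar>f'\<bar> \<le> 2\<close> and \<open>f'\<close> is 4-Lipschitz (\<open>stein_bounds\<close>, \<open>stein_deriv_lipschitz\<close>).
  Let \<open>W = (S - E S) / \<sigma>\<close>, and let \<open>\<eta>\<^sub>j\<close> be the sum of the \<open>\<zeta>\<^sub>i\<close> with \<open>i \<le> j \<le> i + k\<close>.
  As \<open>W - \<eta>\<^sub>j / \<sigma>\<close> does not depend on the variable \<open>j\<close>,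
  \<open>E (W f W) = \<sigma>\<^sup>-\<^sup>1 \<Sum> E (\<zeta>\<^sub>j (f W - f (W - \<eta>\<^sub>j / \<sigma>)))\<close>, and a Taylor expansion gives
  \<open>\<bar>E h W - E h G\<bar> \<le> 2 \<sigma>\<^sup>-\<^sup>2 E \<bar>\<Sum> \<zeta>\<^sub>j \<eta>\<^sub>j - \<sigma>\<^sup>2\<bar> + 2 \<sigma>\<^sup>-\<^sup>3 \<Sum> E (\<bar>\<zeta>\<^sub>j\<bar> \<eta>\<^sub>j\<^sup>2)\<close>.
  The orthogonality relations bound the last sum by \<open>(k + 1)\<^sup>2 \<sigma>\<^sup>2\<close> (\<open>sum_E_eta\<close>) and the first
  expectation by \<open>2 (k + 1) (2k + 1)\<^sup>1\<^sup>/\<^sup>2 \<sigma>\<close> (\<open>E_defect\<close>).  The resulting bound (\<open>wasserstein_bound\<close>)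
  is at most the claimed one when \<open>k \<ge> 1\<close> (\<open>wasserstein_constant_le\<close>).
\<close>

section \<open>Gaussian tail integrals\<close>

abbreviation (input) \<phi> :: "real \<Rightarrow> real" where "\<phi> \<equiv> std_normal_density"

lemma std_normal_density_pos: "0 < \<phi> x" by (rule normal_density_pos) simp

lemma DERIV_std_normal_density: "(\<phi> has_real_derivative - x * \<phi> x) (at x)"
  unfolding std_normal_density_def
  by (rule derivative_eq_intros refl | simp)+

lemma integral_atLeast_FTC:
  fixes g G :: "real \<Rightarrow> real"
  assumes int: "integrable lborel g" and deriv: "\<And>x. (G has_real_derivative g x) (at x)"
    and cont: "\<And>x. isCont g x" and lim: "(G \<longlongrightarrow> 0) at_top"
  shows "(LBINT x:{w..}. g x) = - G w"
proof -
  have si: "set_integrable lborel {w..} g"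
    using int unfolding set_integrable_def by (rule integrable_mult_indicator[rotated]) simp
  have "((\<lambda>b. LBINT x:{w..b}. g x) \<longlongrightarrow> (LBINT x:{w..}. g x)) at_top"
    by (rule tendsto_set_lebesgue_integral_at_top) (simp_all add: si)
  moreover have "((\<lambda>b. LBINT x:{w..b}. g x) \<longlongrightarrow> 0 - G w) at_top"
  proof (rule Lim_transform_eventually)
    show "((\<lambda>b. G b - G w) \<longlongrightarrow> 0 - G w) at_top"
      by (intro tendsto_intros lim)
    show "\<forall>\<^sub>F b in at_top. G b - G w = (LBINT x:{w..b}. g x)"
      using eventually_ge_at_top[of w]
    proof eventually_elim
      case (elim b)
      show ?case
        using integral_FTC_Icc_real[OF elim deriv cont]
        by (simp add: set_lebesgue_integral_def mult.commute)
    qed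
  qed
  ultimately show ?thesis
    using tendsto_unique[OF trivial_limit_at_top_linorder] by fastforce
qed

lemma tendsto_poly_std_normal:
  "((\<lambda>x. x ^ n * \<phi> x) \<longlongrightarrow> 0) at_top"
proof -
  have "((\<lambda>x::real. x ^ n / exp x * exp (x - x\<^sup>2/2) * (1 / sqrt (2 * pi))) \<longlongrightarrow> 0 * 0 * (1 / sqrt (2 * pi))) at_top"
    by (intro tendsto_intros tendsto_power_div_exp_0) real_asymp
  moreover have "x ^ n / exp x * exp (x - x\<^sup>2/2) * (1 / sqrt (2 * pi)) = x ^ n * \<phi> x" for x :: real
  proof -
    have "exp (x - x\<^sup>2/2) = exp x * exp (- x\<^sup>2/2)"
      by (simp add: exp_add[symmetric])
    then show ?thesis by (simp add: std_normal_density_def)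
  qed
  ultimately show ?thesis by simp
qed

lemma integrable_cubic_std_normal:
  "integrable lborel (\<lambda>x. (a + b * x + c * x ^ 2 + d * x ^ 3) * \<phi> x)"
proof -
  have "integrable lborel (\<lambda>x. a * (\<phi> x * x ^ 0) + b * (\<phi> x * x ^ 1) + c * (\<phi> x * x ^ 2) + d * (\<phi> x * x ^ 3))"
    by (intro Bochner_Integration.integrable_add integrable_mult_right integrable_std_normal_moment)
  then show ?thesis by (simp add: algebra_simps)
qed

text \<open>The upper tail probability of the standard normal law.\<close>

definition gtail :: "real \<Rightarrow> real" where
  "gtail w = (LBINT x:{w..}. \<phi> x)"

lemma set_integrable_cubic_std_normal:
  assumes "A \<in> sets borel"
  shows "set_integrable lborel A (\<lambda>x. (a + b * x + c * x ^ 2 + d * x ^ 3) * \<phi> x)"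
  unfolding set_integrable_def
  by (rule integrable_mult_indicator[OF _ integrable_cubic_std_normal]) (use assms in simp)

text \<open>
  Up to a multiple of \<open>\<phi>\<close>, a cubic polynomial times \<open>\<phi>\<close> has the antiderivative
  \<open>x \<mapsto> - (b + 2 d + c x + d x\<^sup>2) \<phi> x\<close>.  This expresses the tail integrals of \<open>(x - w)\<^sup>j \<phi> x\<close>, for
  \<open>j \<le> 3\<close>, by \<open>gtail w\<close> and \<open>\<phi> w\<close>.
\<close>

lemma integral_atLeast_cubic:
  "(LBINT x:{w..}. (a + b * x + c * x ^ 2 + d * x ^ 3) * \<phi> x) =
     (b + 2 * d + c * w + d * w ^ 2) * \<phi> w + (a + c) * gtail w"
proof -
  let ?g = "\<lambda>x. (- c + b * x + c * x ^ 2 + d * x ^ 3) * \<phi> x"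
  let ?G = "\<lambda>x. - ((b + 2 * d + c * x + d * x ^ 2) * \<phi> x)"
  have lim: "(?G \<longlongrightarrow> 0) at_top"
  proof -
    have "((\<lambda>x. - ((b + 2 * d) * (x ^ 0 * \<phi> x) + c * (x ^ 1 * \<phi> x) + d * (x ^ 2 * \<phi> x))) \<longlongrightarrow>
        - ((b + 2 * d) * 0 + c * 0 + d * 0)) at_top"
      by (intro tendsto_intros tendsto_poly_std_normal)
    then show ?thesis by (simp add: algebra_simps)
  qed
  have deriv: "(?G has_real_derivative ?g x) (at x)" for x
    by (rule derivative_eq_intros DERIV_std_normal_density refl | simp)+
       (simp add: algebra_simps power2_eq_square power3_eq_cube)
  have cont: "isCont ?g x" for x
    by (intro continuous_intros DERIV_isCont[OF DERIV_std_normal_density])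
  have 1: "(LBINT x:{w..}. ?g x) = - ?G w"
    by (rule integral_atLeast_FTC[OF integrable_cubic_std_normal deriv cont lim])
  have "(LBINT x:{w..}. (a + b * x + c * x ^ 2 + d * x ^ 3) * \<phi> x) =
        (LBINT x:{w..}. ?g x + ((a + c) + 0 * x + 0 * x ^ 2 + 0 * x ^ 3) * \<phi> x)"
    by (simp add: algebra_simps)
  also have "\<dots> = (LBINT x:{w..}. ?g x) + (LBINT x:{w..}. ((a + c) + 0 * x + 0 * x ^ 2 + 0 * x ^ 3) * \<phi> x)"
    by (rule set_integral_add; rule set_integrable_cubic_std_normal; simp)
  also have "(LBINT x:{w..}. ((a + c) + 0 * x + 0 * x ^ 2 + 0 * x ^ 3) * \<phi> x) = (a + c) * gtail w"
    by (simp add: gtail_def)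
  finally show ?thesis using 1 by simp
qed

lemma integral_atLeast_cubic_nonneg:
  assumes "\<And>x. w \<le> x \<Longrightarrow> 0 \<le> a + b * x + c * x ^ 2 + d * x ^ 3"
  shows "0 \<le> (b + 2 * d + c * w + d * w ^ 2) * \<phi> w + (a + c) * gtail w"
  unfolding integral_atLeast_cubic[symmetric] set_lebesgue_integral_def
  by (rule integral_nonneg_AE) (auto simp: indicator_def intro!: AE_I2 mult_nonneg_nonneg assms)

text \<open>
  Here \<open>S\<close> and \<open>T = (1 + w\<^sup>2) gtail w - w \<phi> w\<close> are the integrals of \<open>(x - w) \<phi> x\<close> and
  \<open>(x - w)\<^sup>2 \<phi> x\<close> over \<open>{w..}\<close>.  The bounds are those needed for the Stein solution.
\<close>

lemma gtail_bounds:
  fixes w :: real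
  assumes w: "0 \<le> w"
  defines "S \<equiv> \<phi> w - w * gtail w"
  shows "0 \<le> S" "(1 + w\<^sup>2) * S \<le> \<phi> w" 
    "(2 * w + 1) * S \<le> 2 * \<phi> w" "0 \<le> (1 + w\<^sup>2) * gtail w - w * \<phi> w"
    "(w + 1) * ((1 + w\<^sup>2) * gtail w - w * \<phi> w) \<le> 2 * \<phi> w"
proof -
  let ?T = "(1 + w\<^sup>2) * gtail w - w * \<phi> w"
  show 1: "0 \<le> S" using integral_atLeast_cubic_nonneg[of w "-w" 1 0 0] by (simp add: S_def)
  have "0 \<le> w\<^sup>2 + - (2 * w) * x + 1 * x\<^sup>2 + 0 * x ^ 3" for x
    using zero_le_power2[of "x - w"] by (simp add: power2_eq_square algebra_simps)
  from integral_atLeast_cubic_nonneg[of w "w\<^sup>2" "-(2*w)" 1 0, OF this]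
  have 2: "0 \<le> ?T" by (simp add: algebra_simps)
  then show "0 \<le> ?T" .
  have "w * ?T \<ge> 0" using w 2 by simp
  then show 3: "(1 + w\<^sup>2) * S \<le> \<phi> w"
    by (simp add: S_def algebra_simps power2_eq_square)
  have "2 * w + 1 \<le> 2 * (1 + w\<^sup>2)"
    using zero_le_power2[of "2 * w - 1"] by (simp add: power2_eq_square algebra_simps)
  then have "(2 * w + 1) * S \<le> 2 * (1 + w\<^sup>2) * S" using 1 by (rule mult_right_mono)
  also have "\<dots> \<le> 2 * \<phi> w" using mult_left_mono[OF 3, of 2] by (simp only: mult.assoc)
  finally show "(2 * w + 1) * S \<le> 2 * \<phi> w" .
  \<comment> \<open>With \<open>y = x - w\<close>, the inequality \<open>y\<^sup>2 \<le> 3/4 y + y\<^sup>3/3\<close> is \<open>0 \<le> y/3 (y - 3/2)\<^sup>2\<close>; the integral of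
      \<open>(x - w)\<^sup>3 \<phi> x\<close> is \<open>2 S - w T\<close>, so integrating bounds \<open>T\<close> by \<open>17/12 S\<close>.\<close>
  have "0 \<le> (- 3/4 * w - w ^ 2 - w ^ 3 / 3) + (3/4 + 2 * w + w ^ 2) * x + (- 1 - w) * x ^ 2 + 1/3 * x ^ 3"
    if "w \<le> x" for x
  proof -
    have "0 \<le> (x - w) / 3 * (x - w - 3/2) ^ 2" using that by simp
    also have "\<dots> = (- 3/4 * w - w ^ 2 - w ^ 3 / 3) + (3/4 + 2 * w + w ^ 2) * x + (- 1 - w) * x ^ 2 + 1/3 * x ^ 3"
      by (simp add: power2_eq_square power3_eq_cube field_simps)
    finally show ?thesis .
  qed
  from integral_atLeast_cubic_nonneg[of w, OF this]
  have "?T \<le> 3/4 * S + 1/3 * (2 * S - w * ?T)"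
    by (simp add: S_def power2_eq_square power3_eq_cube field_simps)
  moreover have "t \<le> 17/12 * s" if "t \<le> 3/4 * s + 1/3 * (2 * s - t')" "0 \<le> t'" for s t t' :: real
    using that by (simp add: algebra_simps)
  ultimately have 4: "?T \<le> 17/12 * S" using \<open>w * ?T \<ge> 0\<close> by blast
  have "(w + 1) * ?T \<le> (w + 1) * (17/12 * S)" using w 4 by (intro mult_left_mono) auto
  also have "\<dots> = ((w + 1) * 17/12) * S" by simp
  also have "\<dots> \<le> (2 * (1 + w\<^sup>2)) * S"
  proof (rule mult_right_mono[OF _ 1])
    show "(w + 1) * 17 / 12 \<le> 2 * (1 + w\<^sup>2)"
      using zero_le_power2[of "48 * w - 17"] by (simp add: power2_eq_square algebra_simps)
  qed
  also have "\<dots> \<le> 2 * \<phi> w" using mult_left_mono[OF 3, of 2] by (simp only: mult.assoc)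
  finally show "(w + 1) * ?T \<le> 2 * \<phi> w" .
qed

section \<open>The Stein equation for Lipschitz test functions\<close>

text \<open>The expectation of \<open>h\<close> under the standard normal law.\<close>

definition gauss_mean :: "(real \<Rightarrow> real) \<Rightarrow> real" where
  "gauss_mean h = (\<integral>x. \<phi> x * h x \<partial>lborel)"

text \<open>
  A solution \<open>f\<close> of the Stein equation \<open>f' w - w f w = h w - gauss_mean h\<close>, and its
  derivative, which is read off from the equation.
\<close>

definition stein_sol :: "(real \<Rightarrow> real) \<Rightarrow> real \<Rightarrow> real" where
  "stein_sol h w = (LBINT x:{..w}. (h x - gauss_mean h) * \<phi> x) / \<phi> w"

definition stein_deriv :: "(real \<Rightarrow> real) \<Rightarrow> real \<Rightarrow> real" where
  "stein_deriv h w = w * stein_sol h w + (h w - gauss_mean h)"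

lemma integral_std_normal_expectation:
  assumes "h \<in> borel_measurable borel"
  shows "(\<integral>x. h x \<partial>std_normal_distribution) = gauss_mean h"
  using assms unfolding gauss_mean_def
  by (subst integral_density) (auto)

context
  fixes h :: "real \<Rightarrow> real"
  assumes lip: "1-lipschitz_on UNIV h"
begin

lemma lipschitz_abs: "\<bar>h x - h y\<bar> \<le> \<bar>x - y\<bar>"
  using lipschitz_onD[OF lip, of x y] by (simp add: dist_real_def)

lemma lipschitz_continuous_on: "continuous_on A h"
  using lipschitz_on_continuous_on[OF lip] continuous_on_subset by blast

lemma lipschitz_borel [measurable]: "h \<in> borel_measurable borel"
  by (rule borel_measurable_continuous_onI[OF lipschitz_continuous_on])

lemma integrable_lipschitz: "integrable lborel (\<lambda>x. (h x - c) * \<phi> x)"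
proof (rule Bochner_Integration.integrable_bound)
  show "integrable lborel (\<lambda>x. ((\<bar>h 0 - c\<bar> + 1) + 0 * x + 1 * x ^ 2 + 0 * x ^ 3) * \<phi> x)"
    by (rule integrable_cubic_std_normal)
  have "\<bar>h x - c\<bar> \<le> \<bar>h 0 - c\<bar> + 1 + x\<^sup>2" for x
  proof -
    have "\<bar>x\<bar> \<le> 1 + x\<^sup>2"
      using zero_le_power2[of "\<bar>x\<bar> - 1"] zero_le_power2[of x] by (simp add: power2_diff)
    then show ?thesis using lipschitz_abs[of x 0] by linarith
  qed
  then show "AE x in lborel. norm ((h x - c) * \<phi> x)
      \<le> norm (((\<bar>h 0 - c\<bar> + 1) + 0 * x + 1 * x ^ 2 + 0 * x ^ 3) * \<phi> x)"
    by (auto simp: abs_mult abs_of_nonneg add_nonneg_nonneg intro!: mult_right_mono)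
qed simp

lemma set_integrable_lipschitz:
  "A \<in> sets borel \<Longrightarrow> set_integrable lborel A (\<lambda>x. (h x - c) * \<phi> x)"
  unfolding set_integrable_def
  by (rule integrable_mult_indicator[OF _ integrable_lipschitz]) simp

lemma integral_minus_const: "(\<integral>x. (h x - c) * \<phi> x \<partial>lborel) = gauss_mean h - c"
proof -
  have "(\<integral>x. (h x - c) * \<phi> x \<partial>lborel) = (\<integral>x. (h x - 0) * \<phi> x - c * \<phi> x \<partial>lborel)"
    by (simp add: left_diff_distrib)
  also have "\<dots> = (\<integral>x. (h x - 0) * \<phi> x \<partial>lborel) - (\<integral>x. c * \<phi> x \<partial>lborel)"
    by (rule Bochner_Integration.integral_diff[OF integrable_lipschitz]) simp
  finally show ?thesis by (simp add: gauss_mean_def mult.commute)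
qed

lemma gauss_mean_close: "\<bar>h w - gauss_mean h\<bar> \<le> \<bar>w\<bar> + 1"
proof -
  have "(\<integral>x. (h x - h w) * \<phi> x \<partial>lborel) = gauss_mean h - h w" by (rule integral_minus_const)
  moreover have "\<bar>\<integral>x. (h x - h w) * \<phi> x \<partial>lborel\<bar> \<le> (\<integral>x. (\<bar>w\<bar> + 1/2) * (\<phi> x * x ^ (2 * 0)) + 1/2 * (\<phi> x * x ^ (2 * 1)) \<partial>lborel)"
  proof (rule order_trans[OF integral_abs_bound], rule integral_mono)
    show "integrable lborel (\<lambda>x. \<bar>(h x - h w) * \<phi> x\<bar>)"
      using integrable_lipschitz by simp
    show "integrable lborel (\<lambda>x. (\<bar>w\<bar> + 1/2) * (\<phi> x * x ^ (2 * 0)) + 1/2 * (\<phi> x * x ^ (2 * 1)))"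
      by (intro Bochner_Integration.integrable_add integrable_mult_right integrable_std_normal_moment)
    fix x :: real
    have "\<bar>x\<bar> \<le> 1/2 + 1/2 * x\<^sup>2"
      using zero_le_power2[of "\<bar>x\<bar> - 1"] by (simp add: power2_diff)
    then have "\<bar>h x - h w\<bar> \<le> \<bar>w\<bar> + 1/2 + 1/2 * x\<^sup>2"
      using lipschitz_abs[of x w] by linarith
    then have "\<bar>h x - h w\<bar> * \<phi> x \<le> (\<bar>w\<bar> + 1/2 + 1/2 * x\<^sup>2) * \<phi> x"
      by (rule mult_right_mono) simp
    then show "\<bar>(h x - h w) * \<phi> x\<bar> \<le> (\<bar>w\<bar> + 1/2) * (\<phi> x * x ^ (2 * 0)) + 1/2 * (\<phi> x * x ^ (2 * 1))"
      unfolding abs_mult by (simp add: algebra_simps power2_eq_square)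
  qed
  moreover have "(\<integral>x. (\<bar>w\<bar> + 1/2) * (\<phi> x * x ^ (2 * 0)) + 1/2 * (\<phi> x * x ^ (2 * 1)) \<partial>lborel) = \<bar>w\<bar> + 1"
    by (subst Bochner_Integration.integral_add;
        (intro integrable_mult_right integrable_std_normal_moment)?)
       (simp only: integral_mult_right_zero integral_std_normal_moment_even; simp)
  ultimately show ?thesis by simp
qed

lemma DERIV_stein_sol: "(stein_sol h has_real_derivative stein_deriv h w) (at w)"
proof -
  define g where "g = (\<lambda>x. (h x - gauss_mean h) * \<phi> x)"
  define F where "F = (\<lambda>w. LBINT x:{..w}. g x)"
  have cont: "continuous_on A g" for A
    unfolding g_def std_normal_density_def
    by (intro continuous_intros lipschitz_continuous_on) auto
  have si: "set_integrable lborel A g" if "A \<in> sets borel" for A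
    unfolding g_def by (rule set_integrable_lipschitz[OF that])
  have "(F has_real_derivative g w) (at w)"
  proof -
    have "((\<lambda>u. integral {w - 1..u} g) has_vector_derivative g w) (at w within {w - 1..w + 1})"
      by (rule integral_has_vector_derivative) (auto intro: cont)
    then have "((\<lambda>u. integral {w - 1..u} g) has_real_derivative g w) (at w)"
      unfolding has_real_derivative_iff_has_vector_derivative
      by (subst (asm) at_within_interior) auto
    then have *: "((\<lambda>u. F (w - 1) + integral {w - 1..u} g) has_real_derivative g w) (at w)"
      using DERIV_add[OF DERIV_const] by fastforce
    have **: "F (w - 1) + integral {w - 1..u} g = F u" if "w - 1 < u" for u
    proof -
      have "AE x in lborel. \<not> (x \<in> {..w - 1} \<and> x \<in> {w - 1..u})"
        using AE_lborel_singleton[of "w - 1"] by (auto elim!: eventually_mono)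
      then have "(LBINT x:{..w - 1} \<union> {w - 1..u}. g x) = F (w - 1) + (LBINT x:{w - 1..u}. g x)"
        unfolding F_def by (rule set_integral_Un_AE) (auto intro: si)
      also have "{..w - 1} \<union> {w - 1..u} = {..u}" using that by auto
      also have "(LBINT x:{w - 1..u}. g x) = integral {w - 1..u} g"
        by (rule set_borel_integral_eq_integral(2)[OF si]) simp
      finally show ?thesis by (simp add: F_def)
    qed
    have "\<forall>\<^sub>F u in nhds w. u \<in> {w - 1<..}"
      by (rule eventually_nhds_in_open) auto
    then have "\<forall>\<^sub>F u in nhds w. F (w - 1) + integral {w - 1..u} g = F u"
      by eventually_elim (rule **, simp)
    from DERIV_cong_ev[OF refl this refl] * show ?thesis by blast
  qed
  moreover have sol: "stein_sol h = (\<lambda>w. F w / \<phi> w)" by (simp add: stein_sol_def F_def g_def fun_eq_iff)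
  ultimately have "(stein_sol h has_real_derivative
      (g w * \<phi> w - F w * (- w * \<phi> w)) / (\<phi> w * \<phi> w)) (at w)"
    unfolding sol using std_normal_density_pos[of w]
    by (intro DERIV_divide DERIV_std_normal_density) auto
  also have "(g w * \<phi> w - F w * (- w * \<phi> w)) / (\<phi> w * \<phi> w) = stein_deriv h w"
    using std_normal_density_pos[of w] unfolding stein_deriv_def sol g_def by (simp add: field_simps)
  finally show ?thesis .
qed

text \<open>
  The second quantity is the derivative of \<open>w \<mapsto> w f w\<close>, where \<open>f\<close> is the Stein solution.  For
  \<open>w \<ge> 0\<close> the solution is minus the integral over the upper tail, where \<open>h x\<close> is replaced by \<open>h w\<close>
  at the cost \<open>x - w\<close>.
\<close>

lemma stein_bounds_nonneg:
  assumes w: "0 \<le> w"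
  shows "\<bar>stein_deriv h w\<bar> \<le> 2" "\<bar>stein_sol h w + w * stein_deriv h w\<bar> \<le> 3"
proof -
  let ?u = "h w - gauss_mean h" and ?S = "\<phi> w - w * gtail w"
  let ?T = "(1 + w\<^sup>2) * gtail w - w * \<phi> w"
  define r where "r = (LBINT x:{w..}. (h x - h w) * \<phi> x)"
  note bd = gtail_bounds[OF w]
  have pos: "0 < \<phi> w" by (rule std_normal_density_pos)
  have r: "\<bar>r\<bar> \<le> ?S"
  proof -
    have "\<bar>r\<bar> \<le> (LBINT x:{w..}. (- w + 1 * x + 0 * x ^ 2 + 0 * x ^ 3) * \<phi> x)"
      unfolding r_def set_lebesgue_integral_def
    proof (rule order_trans[OF integral_abs_bound], rule integral_mono)
      show "integrable lborel (\<lambda>x. \<bar>indicator {w..} x *\<^sub>R ((h x - h w) * \<phi> x)\<bar>)"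
        using set_integrable_lipschitz[of "{w..}" "h w"] unfolding set_integrable_def by simp
      show "integrable lborel (\<lambda>x. indicator {w..} x *\<^sub>R ((- w + 1 * x + 0 * x ^ 2 + 0 * x ^ 3) * \<phi> x))"
        by (rule set_integrable_cubic_std_normal[unfolded set_integrable_def]) simp
      show "\<bar>indicator {w..} x *\<^sub>R ((h x - h w) * \<phi> x)\<bar> \<le> indicator {w..} x *\<^sub>R ((- w + 1 * x + 0 * x ^ 2 + 0 * x ^ 3) * \<phi> x)" for x
        using lipschitz_abs[of x w] by (auto simp: indicator_def abs_mult intro!: mult_right_mono)
    qed
    also have "\<dots> = ?S" unfolding integral_atLeast_cubic by simp
    finally show ?thesis .
  qed
  have sol: "stein_sol h w * \<phi> w = - (?u * gtail w + r)"
  proof -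
    have ae: "AE x in lborel. \<not> (x \<in> {..w} \<and> x \<in> {w..})"
      using AE_lborel_singleton[of w] by (auto elim!: eventually_mono)
    have "{..w} \<union> {w..} = UNIV" by auto
    then have "(\<integral>x. (h x - gauss_mean h) * \<phi> x \<partial>lborel) = (LBINT x:{..w} \<union> {w..}. (h x - gauss_mean h) * \<phi> x)"
      by (simp add: set_lebesgue_integral_def)
    also have "\<dots> = (LBINT x:{..w}. (h x - gauss_mean h) * \<phi> x) + (LBINT x:{w..}. (h x - gauss_mean h) * \<phi> x)"
      by (rule set_integral_Un_AE[OF ae]) (auto intro: set_integrable_lipschitz)
    also have "(LBINT x:{w..}. (h x - gauss_mean h) * \<phi> x) = (LBINT x:{w..}. (h x - h w) * \<phi> x + ?u * \<phi> x)"
      by (simp add: algebra_simps)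
    also have "\<dots> = r + ?u * gtail w"
      unfolding r_def gtail_def
      by (subst set_integral_add(2), rule set_integrable_lipschitz, simp,
          rule set_integrable_cubic_std_normal[of "{w..}" ?u 0 0 0, simplified], simp)
    finally show ?thesis
      using pos by (simp add: integral_minus_const stein_sol_def)
  qed
  have u: "\<bar>?u\<bar> \<le> w + 1" using gauss_mean_close[of w] w by simp
  have "stein_deriv h w * \<phi> w = ?u * ?S - w * r"
  proof -
    have "stein_deriv h w * \<phi> w = w * (stein_sol h w * \<phi> w) + ?u * \<phi> w"
      unfolding stein_deriv_def by (simp add: algebra_simps)
    then show ?thesis unfolding sol by (simp add: algebra_simps)
  qed
  then have "\<bar>stein_deriv h w * \<phi> w\<bar> \<le> \<bar>?u\<bar> * ?S + w * \<bar>r\<bar>"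
    using w bd(1) abs_triangle_ineq4[of "?u * ?S" "w * r"] by (simp add: abs_mult)
  also have "\<dots> \<le> (w + 1) * ?S + w * ?S"
    by (intro add_mono mult_mono u r bd w order_refl) (use w in auto)
  also have "\<dots> \<le> 2 * \<phi> w" using bd(3) by (simp add: algebra_simps)
  finally show "\<bar>stein_deriv h w\<bar> \<le> 2" using pos by (simp add: abs_mult)
  have "(stein_sol h w + w * stein_deriv h w) * \<phi> w = - (?u * ?T + (1 + w\<^sup>2) * r)"
  proof -
    have "(stein_sol h w + w * stein_deriv h w) * \<phi> w = (1 + w\<^sup>2) * (stein_sol h w * \<phi> w) + w * ?u * \<phi> w"
      unfolding stein_deriv_def by (simp add: algebra_simps power2_eq_square)
    then show ?thesis unfolding sol by (simp add: algebra_simps power2_eq_square)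
  qed
  then have "\<bar>(stein_sol h w + w * stein_deriv h w) * \<phi> w\<bar> \<le> \<bar>?u\<bar> * ?T + (1 + w\<^sup>2) * \<bar>r\<bar>"
    using bd(4) abs_triangle_ineq[of "?u * ?T" "(1 + w\<^sup>2) * r"] by (simp add: abs_mult del: minus_add_distrib)
  also have "\<dots> \<le> (w + 1) * ?T + (1 + w\<^sup>2) * ?S"
    by (intro add_mono mult_mono u r bd order_refl) (use w in auto)
  also have "\<dots> \<le> 3 * \<phi> w" using bd(2,5) by simp
  finally show "\<bar>stein_sol h w + w * stein_deriv h w\<bar> \<le> 3" using pos by (simp add: abs_mult)
qed

end

lemma lipschitz_reflect: "1-lipschitz_on UNIV h \<Longrightarrow> 1-lipschitz_on UNIV (\<lambda>x::real. h (- x) :: real)"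
  by (auto simp: lipschitz_on_def dist_real_def abs_minus_commute) (metis minus_diff_minus abs_minus_cancel)

lemma std_normal_density_minus: "\<phi> (- x) = \<phi> x"
  by (simp add: std_normal_density_def)

lemma gauss_mean_reflect: "gauss_mean (\<lambda>x. h (- x)) = gauss_mean h"
  unfolding gauss_mean_def
  using lborel_integral_real_affine[of "-1" "\<lambda>x. \<phi> x * h x" 0] by (simp add: std_normal_density_minus)

lemma stein_sol_reflect:
  assumes lip: "1-lipschitz_on UNIV h"
  shows "stein_sol (\<lambda>x. h (- x)) (- w) = - stein_sol h w"
proof -
  have ae: "AE x in lborel. \<not> (x \<in> {..w} \<and> x \<in> {w..})"
    using AE_lborel_singleton[of w] by (auto elim!: eventually_mono)
  have "(LBINT x:{..- w}. (h (- x) - gauss_mean h) * \<phi> x) = (LBINT x:{w..}. (h x - gauss_mean h) * \<phi> x)"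
    unfolding set_lebesgue_integral_def
    using lborel_integral_real_affine[of "-1" "\<lambda>x. indicator {w..} x *\<^sub>R ((h x - gauss_mean h) * \<phi> x)" 0]
    by (auto simp: std_normal_density_minus indicator_def intro!: Bochner_Integration.integral_cong)
  moreover have "(LBINT x:{..w} \<union> {w..}. (h x - gauss_mean h) * \<phi> x) = 
    (LBINT x:{..w}. (h x - gauss_mean h) * \<phi> x) + (LBINT x:{w..}. (h x - gauss_mean h) * \<phi> x)"
    by (rule set_integral_Un_AE[OF ae]) (auto intro: set_integrable_lipschitz[OF lip])
  moreover have "{..w} \<union> {w..} = UNIV" by auto
  then have "(LBINT x:{..w} \<union> {w..}. (h x - gauss_mean h) * \<phi> x) = 0"
    by (simp add: set_lebesgue_integral_def integral_minus_const[OF lip])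
  ultimately show ?thesis
    unfolding stein_sol_def gauss_mean_reflect std_normal_density_minus
    by (simp add: field_simps std_normal_density_pos[THEN less_imp_neq, symmetric])
qed

lemma stein_deriv_reflect:
  assumes lip: "1-lipschitz_on UNIV h"
  shows "stein_deriv (\<lambda>x. h (- x)) (- w) = stein_deriv h w"
  unfolding stein_deriv_def stein_sol_reflect[OF lip] gauss_mean_reflect by simp

lemma stein_bounds:
  assumes lip: "1-lipschitz_on UNIV h"
  shows "\<bar>stein_deriv h w\<bar> \<le> 2" "\<bar>stein_sol h w + w * stein_deriv h w\<bar> \<le> 3"
proof (atomize(full), cases "0 \<le> w")
  case True
  then show "\<bar>stein_deriv h w\<bar> \<le> 2 \<and> \<bar>stein_sol h w + w * stein_deriv h w\<bar> \<le> 3"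
    using stein_bounds_nonneg[OF lip] by simp
next
  case False
  have "stein_sol h w + w * stein_deriv h w =
      - (stein_sol (\<lambda>x. h (- x)) (- w) + (- w) * stein_deriv (\<lambda>x. h (- x)) (- w))"
    unfolding stein_sol_reflect[OF lip] stein_deriv_reflect[OF lip] by simp
  moreover note stein_deriv_reflect[OF lip, of w, symmetric]
  ultimately show "\<bar>stein_deriv h w\<bar> \<le> 2 \<and> \<bar>stein_sol h w + w * stein_deriv h w\<bar> \<le> 3"
    using False stein_bounds_nonneg[OF lipschitz_reflect[OF lip], of "- w"] by (simp only: abs_minus_cancel)
qed

text \<open>
  Only \<open>w \<mapsto> w f w\<close> is differentiated, so \<open>h\<close> need not be differentiable.
\<close>

lemma stein_deriv_lipschitz:
  assumes lip: "1-lipschitz_on UNIV h"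
  shows "\<bar>stein_deriv h x - stein_deriv h y\<bar> \<le> 4 * \<bar>x - y\<bar>"
proof -
  have deriv: "((\<lambda>w. w * stein_sol h w) has_real_derivative (stein_sol h w + w * stein_deriv h w)) (at w within UNIV)" for w
    using DERIV_mult[OF DERIV_ident DERIV_stein_sol[OF lip, of w]] by (simp add: ac_simps)
  have "norm (x * stein_sol h x - y * stein_sol h y) \<le> 3 * norm (x - y)"
    by (rule field_differentiable_bound[OF _ deriv]) (use stein_bounds(2)[OF lip] in auto)
  then show ?thesis
    unfolding stein_deriv_def using lipschitz_abs[OF lip, of x y] by (simp only: real_norm_def) argo
qed

lemma taylor_lipschitz_deriv:
  fixes f f' :: "real \<Rightarrow> real"
  assumes deriv: "\<And>x. (f has_real_derivative f' x) (at x)"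
    and lip: "\<And>x y. \<bar>f' x - f' y\<bar> \<le> L * \<bar>x - y\<bar>"
  shows "\<bar>f y - f x - (y - x) * f' x\<bar> \<le> L / 2 * (y - x)\<^sup>2"
proof -
  have main: "s * (f (x + u * t) - f x - u * t * f' x) \<le> L / 2 * t\<^sup>2"
    if t: "0 \<le> t" and u: "u = 1 \<or> u = - 1" and s: "s = 1 \<or> s = -1" for t u s
  proof -
    let ?g = "\<lambda>t. s * (f (x + u * t) - f x - u * t * f' x) - L / 2 * t\<^sup>2"
    have "?g t \<le> ?g 0"
    proof (rule DERIV_nonpos_imp_nonincreasing[OF t])
      fix v assume v: "0 \<le> v" "v \<le> t"
      have "((\<lambda>t. f (x + u * t)) has_real_derivative f' (x + u * v) * u) (at v)"
        by (rule DERIV_chain2[OF deriv]) (auto intro!: derivative_eq_intros)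
      then have "(?g has_real_derivative s * (f' (x + u * v) * u - u * f' x) - L * v) (at v)"
        by (auto intro!: derivative_eq_intros)
      moreover have "\<bar>s * (f' (x + u * v) * u - u * f' x)\<bar> \<le> L * v"
        using lip[of "x + u * v" x] u s v by (auto simp: abs_mult abs_minus_commute)
      ultimately show "\<exists>y. (?g has_real_derivative y) (at v) \<and> y \<le> 0"
        by (intro exI[of _ "s * (f' (x + u * v) * u - u * f' x) - L * v"]) (auto simp: abs_le_iff)
    qed
    then show ?thesis by simp
  qed
  show ?thesis
  proof (cases "x \<le> y")
    case True
    show ?thesis using main[of "y - x" 1 1] main[of "y - x" 1 "-1"] True
      by (simp add: abs_if)
  next
    case False
    show ?thesis using main[of "x - y" "-1" 1] main[of "x - y" "-1" "-1"] False
      by (simp add: abs_if power2_commute)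
  qed
qed

section \<open>Normal approximation for sums of functions of consecutive independent variables\<close>

text \<open>
  \<open>g\<close> is a function of the coordinates in \<open>A\<close> only.
\<close>

definition depends_on :: "nat set \<Rightarrow> ((nat \<Rightarrow> 'a) \<Rightarrow> 'b) \<Rightarrow> bool" where
  "depends_on A g \<longleftrightarrow> (\<forall>x y. (\<forall>i\<in>A. x i = y i) \<longrightarrow> g x = g y)"

lemma depends_onD: "depends_on A g \<Longrightarrow> (\<And>i. i \<in> A \<Longrightarrow> x i = y i) \<Longrightarrow> g x = g y"
  unfolding depends_on_def by blast

lemma depends_on_mono: "depends_on A g \<Longrightarrow> A \<subseteq> B \<Longrightarrow> depends_on B g"
  unfolding depends_on_def by blast

lemma depends_on_comp: "depends_on A g \<Longrightarrow> depends_on A (\<lambda>x. u (g x))"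
  unfolding depends_on_def by metis

lemma depends_on_comp2: "depends_on A g \<Longrightarrow> depends_on A g' \<Longrightarrow> depends_on A (\<lambda>x. u (g x) (g' x))"
  unfolding depends_on_def by metis

lemma depends_on_sum: "(\<And>i. i \<in> J \<Longrightarrow> depends_on A (g i)) \<Longrightarrow> depends_on A (\<lambda>x. \<Sum>i\<in>J. g i x)"
  unfolding depends_on_def by (intro allI impI sum.cong refl) simp

text \<open>
  Combining the coordinates in \<open>A\<close> of a sample with the remaining coordinates of an independent
  sample gives a sample again.
\<close>

lemma map_override_on_Pi_pmf:
  assumes I: "finite I"
  shows "map_pmf (\<lambda>(x, y). override_on y x A) (pair_pmf (Pi_pmf I d P) (Pi_pmf I d P)) = Pi_pmf I d P"
    (is "map_pmf _ (pair_pmf ?Q ?Q) = ?Q")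
proof -
  let ?r = "\<lambda>B f x. if x \<in> B then f x else d"
  have Q: "x i = d" if "x \<in> set_pmf ?Q" "i \<notin> I" for x i
    using set_Pi_pmf_subset[OF I, of d P] that by auto
  let ?h = "\<lambda>(f, g) x. if x \<in> I \<inter> A then f x else g x"
  have r1: "Pi_pmf (I \<inter> A) d P = map_pmf (?r (I \<inter> A)) ?Q" by (rule Pi_pmf_subset[OF I]) simp
  have r2: "Pi_pmf (I - A) d P = map_pmf (?r (I - A)) ?Q" by (rule Pi_pmf_subset[OF I]) simp
  have "Pi_pmf ((I \<inter> A) \<union> (I - A)) d P = map_pmf ?h (pair_pmf (Pi_pmf (I \<inter> A) d P) (Pi_pmf (I - A) d P))"
    by (rule Pi_pmf_union) (use I in auto)
  then have "?Q = map_pmf ?h (pair_pmf (Pi_pmf (I \<inter> A) d P) (Pi_pmf (I - A) d P))"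
    by (simp only: Int_Diff_Un)
  also have "\<dots> = map_pmf ?h (map_pmf (\<lambda>(f, g). (?r (I \<inter> A) f, ?r (I - A) g)) (pair_pmf ?Q ?Q))"
    unfolding r1 r2 by (rule arg_cong[OF map_pair[symmetric]])
  also have "\<dots> = map_pmf (\<lambda>xy. ?h (case xy of (f, g) \<Rightarrow> (?r (I \<inter> A) f, ?r (I - A) g))) (pair_pmf ?Q ?Q)"
    by (rule map_pmf_comp)
  also have "\<dots> = map_pmf (\<lambda>(x, y). override_on y x A) (pair_pmf ?Q ?Q)"
  proof (rule map_pmf_cong[OF refl])
    fix xy assume xy: "xy \<in> set_pmf (pair_pmf ?Q ?Q)"
    show "?h (case xy of (f, g) \<Rightarrow> (?r (I \<inter> A) f, ?r (I - A) g)) = (case xy of (x, y) \<Rightarrow> override_on y x A)"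
    proof (cases xy)
      case (Pair x y)
      with xy have "x i = d" "y i = d" if "i \<notin> I" for i
        using that Q[of x i] Q[of y i] by auto
      then show ?thesis unfolding Pair by (auto simp: fun_eq_iff override_on_def)
    qed
  qed
  finally show ?thesis ..
qed

text \<open>
  The summands \<open>X i\<close>, for \<open>i < N\<close>, take values in \<open>[0, 1]\<close> and depend only on the coordinates
  \<open>i, \<dots>, i + k\<close>.  The coordinates \<open>0, \<dots>, m - 1\<close> are independent and finitely supported; the others
  have the fixed value \<open>d\<close> and are never used because \<open>N + k \<le> m\<close>.
\<close>

locale local_sum =
  fixes m N k :: nat and d :: 'a and P :: "nat \<Rightarrow> 'a pmf" and X :: "nat \<Rightarrow> (nat \<Rightarrow> 'a) \<Rightarrow> real"
  assumes finite_P: "\<And>i. finite (set_pmf (P i))"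
    and X_depends: "\<And>i. i < N \<Longrightarrow> depends_on {i..i + k} (X i)"
    and X_bounds: "\<And>i x. i < N \<Longrightarrow> 0 \<le> X i x \<and> X i x \<le> 1"
    and N_le: "N + k \<le> m"
begin

definition Q :: "(nat \<Rightarrow> 'a) pmf" where "Q = Pi_pmf {..<m} d P"

abbreviation E :: "((nat \<Rightarrow> 'a) \<Rightarrow> real) \<Rightarrow> real" where "E \<equiv> measure_pmf.expectation Q"

definition S :: "(nat \<Rightarrow> 'a) \<Rightarrow> real" where "S x = (\<Sum>i<N. X i x)"

lemma finite_Q: "finite (set_pmf Q)"
  unfolding Q_def set_Pi_pmf[OF finite_lessThan]
  by (rule finite_PiE_dflt) (simp_all add: finite_P)

lemma integrable_Q [simp, intro]: "integrable (measure_pmf Q) (f :: _ \<Rightarrow> real)"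
  by (rule integrable_measure_pmf_finite[OF finite_Q])

lemma E_mono: "(\<And>x. f x \<le> g x) \<Longrightarrow> E f \<le> E g"
  by (rule integral_mono) auto

lemma E_sum: "E (\<lambda>x. \<Sum>i\<in>J. f i x) = (\<Sum>i\<in>J. E (f i))"
  by (rule Bochner_Integration.integral_sum) auto

lemma E_resample: "E f = E (\<lambda>x. E (\<lambda>y. f (override_on y x A)))"
proof -
  have "E f = measure_pmf.expectation (map_pmf (\<lambda>(x, y). override_on y x A) (pair_pmf Q Q)) f"
    unfolding Q_def by (simp add: map_override_on_Pi_pmf)
  also have "\<dots> = measure_pmf.expectation (Q \<bind> (\<lambda>x. map_pmf (\<lambda>y. override_on y x A) Q)) f"
    by (simp add: pair_pmf_def map_bind_pmf map_pmf_def bind_assoc_pmf bind_return_pmf)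
  also have "\<dots> = (\<Sum>x\<in>set_pmf Q. pmf Q x *\<^sub>R measure_pmf.expectation (map_pmf (\<lambda>y. override_on y x A) Q) f)"
    by (rule pmf_expectation_bind) (auto simp: finite_Q)
  also have "\<dots> = E (\<lambda>x. E (\<lambda>y. f (override_on y x A)))"
    by (subst integral_measure_pmf[OF finite_Q]) auto
  finally show ?thesis .
qed

lemma E_mult_disjoint:
  assumes f: "depends_on A f" and g: "depends_on B g" and disj: "A \<inter> B = {}"
  shows "E (\<lambda>x. f x * g x) = E f * E g"
proof -
  have "f (override_on y x A) = f x" for x y by (rule depends_onD[OF f]) simp
  moreover have "g (override_on y x A) = g y" for x y
    by (rule depends_onD[OF g]) (use disj in \<open>auto simp: override_on_def\<close>)
  ultimately have "E (\<lambda>x. f x * g x) = E (\<lambda>x. E (\<lambda>y. f x * g y))"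
    using E_resample[of "\<lambda>x. f x * g x" A] by simp
  then show ?thesis by simp
qed

text \<open>
  \<open>G j\<close> is the conditional expectation of \<open>S\<close> given the coordinates \<open>j, j + 1, \<dots>\<close>, realised by
  averaging over an independent copy of the other coordinates, and \<open>zeta j\<close> is the martingale
  difference for revealing the coordinate \<open>j\<close> after all later ones.
\<close>

definition G :: "nat \<Rightarrow> (nat \<Rightarrow> 'a) \<Rightarrow> real" where
  "G j x = E (\<lambda>y. S (override_on y x {j..}))"

definition zeta :: "nat \<Rightarrow> (nat \<Rightarrow> 'a) \<Rightarrow> real" where
  "zeta j x = G j x - G (Suc j) x"

text \<open>
  The tower property: averaging \<open>G j\<close> over the coordinate \<open>j\<close> gives \<open>G (Suc j)\<close>.
\<close>

lemma G_Suc: "G (Suc j) x = E (\<lambda>y. G j (override_on y x (- {j})))"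
proof -
  have "G (Suc j) x = E (\<lambda>y. E (\<lambda>z. S (override_on (override_on z y {j..}) x {Suc j..})))"
    unfolding G_def by (rule E_resample)
  moreover have "override_on (override_on z y {j..}) x {Suc j..} =
      override_on z (override_on y x (- {j})) {j..}" for y z
    by (auto simp: override_on_def fun_eq_iff)
  ultimately show ?thesis by (simp add: G_def)
qed

text \<open>
  Since \<open>zeta j\<close> already averages to 0 over the coordinate \<open>j\<close> alone, \<open>g\<close> may depend on all other
  coordinates, earlier or later.
\<close>

lemma E_zeta_mult:
  assumes g: "depends_on (- {j}) g"
  shows "E (\<lambda>x. zeta j x * g x) = 0"
proof -
  have "g (override_on y x (- {j})) = g x" for x y by (rule depends_onD[OF g]) simp
  then have "E (\<lambda>x. G j x * g x) = E (\<lambda>x. E (\<lambda>y. G j (override_on y x (- {j}))) * g x)"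
    using E_resample[of "\<lambda>x. G j x * g x" "- {j}"] by simp
  also have "\<dots> = E (\<lambda>x. G (Suc j) x * g x)" by (simp add: G_Suc[symmetric])
  finally show ?thesis by (simp add: zeta_def left_diff_distrib)
qed

text \<open>
  Revealing the coordinate \<open>j\<close> affects only the summands whose window contains \<open>j\<close>.
\<close>

lemma zeta_eq:
  "zeta j x = (\<Sum>i\<in>{i. i < N \<and> i \<le> j \<and> j \<le> i + k}.
     E (\<lambda>y. X i (override_on y x {j..}) - X i (override_on y x {Suc j..})))"
proof -
  have "zeta j x = E (\<lambda>y. \<Sum>i<N. X i (override_on y x {j..}) - X i (override_on y x {Suc j..}))"
    by (simp add: zeta_def G_def S_def sum_subtractf)
  also have "\<dots> = (\<Sum>i<N. E (\<lambda>y. X i (override_on y x {j..}) - X i (override_on y x {Suc j..})))"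
    by (rule E_sum)
  also have "\<dots> = (\<Sum>i\<in>{i. i < N \<and> i \<le> j \<and> j \<le> i + k}.
     E (\<lambda>y. X i (override_on y x {j..}) - X i (override_on y x {Suc j..})))"
  proof (rule sum.mono_neutral_right, safe)
    fix i assume i: "i < N" and *: "E (\<lambda>y. X i (override_on y x {j..}) - X i (override_on y x {Suc j..})) \<noteq> 0"
    have "i \<le> j \<and> j \<le> i + k"
    proof (rule ccontr)
      assume out: "\<not> (i \<le> j \<and> j \<le> i + k)"
      have "X i (override_on y x {j..}) = X i (override_on y x {Suc j..})" for y
        by (rule depends_onD[OF X_depends[OF i]]) (use out in \<open>auto simp: override_on_def\<close>)
      with * show False by simp
    qed
    then show "i \<le> j" "j \<le> i + k" by auto
  qed
  finally show ?thesis .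
qed

lemma zeta_depends: "depends_on {j..j + k} (zeta j)"
  unfolding zeta_eq
proof (rule depends_on_sum)
  fix i assume i: "i \<in> {i. i < N \<and> i \<le> j \<and> j \<le> i + k}"
  show "depends_on {j..j + k} (\<lambda>x. E (\<lambda>y. X i (override_on y x {j..}) - X i (override_on y x {Suc j..})))"
    unfolding depends_on_def
  proof (intro allI impI)
    fix x x' :: "nat \<Rightarrow> 'a" assume eq: "\<forall>i\<in>{j..j + k}. x i = x' i"
    have "X i (override_on y x {l..}) = X i (override_on y x' {l..})" if "j \<le> l" for l y
      by (rule depends_onD[OF X_depends]) (use i eq that in \<open>auto simp: override_on_def\<close>)
    then show "E (\<lambda>y. X i (override_on y x {j..}) - X i (override_on y x {Suc j..})) =
        E (\<lambda>y. X i (override_on y x' {j..}) - X i (override_on y x' {Suc j..}))"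
      by simp
  qed
qed

lemma card_window_le: "card {i. i < N' \<and> i \<le> j \<and> j \<le> i + k} \<le> k + 1"
proof -
  have "card {i. i < N' \<and> i \<le> j \<and> j \<le> i + k} \<le> card {j - k..j}"
    by (rule card_mono) auto
  then show ?thesis by simp
qed

lemma zeta_bound: "\<bar>zeta j x\<bar> \<le> real (k + 1)"
proof -
  have "\<bar>zeta j x\<bar> \<le> (\<Sum>i\<in>{i. i < N \<and> i \<le> j \<and> j \<le> i + k}. 1)"
    unfolding zeta_eq
  proof (rule order_trans[OF sum_abs], rule sum_mono)
    fix i assume i: "i \<in> {i. i < N \<and> i \<le> j \<and> j \<le> i + k}"
    have "\<bar>E (\<lambda>y. X i (override_on y x {j..}) - X i (override_on y x {Suc j..}))\<bar> \<le>
        E (\<lambda>y. \<bar>X i (override_on y x {j..}) - X i (override_on y x {Suc j..})\<bar>)"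
      by (rule integral_abs_bound)
    also have "\<dots> \<le> E (\<lambda>y. 1)"
    proof (rule E_mono)
      fix y
      show "\<bar>X i (override_on y x {j..}) - X i (override_on y x {Suc j..})\<bar> \<le> 1"
        using i X_bounds[of i "override_on y x {j..}"] X_bounds[of i "override_on y x {Suc j..}"] by auto
    qed
    finally show "\<bar>E (\<lambda>y. X i (override_on y x {j..}) - X i (override_on y x {Suc j..}))\<bar> \<le> 1" by simp
  qed
  also have "\<dots> \<le> real (k + 1)"
    using card_window_le[of N j] by (simp del: of_nat_Suc of_nat_add)
  finally show ?thesis .
qed

lemma sum_zeta: "(\<Sum>j<m. zeta j x) = S x - E S"
proof -
  have "depends_on {..<m} S"
    unfolding S_def using N_le
    by (intro depends_on_sum depends_on_mono[OF X_depends]) auto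
  then have "S (override_on y x {m..}) = S y" for y
    by (rule depends_onD) auto
  moreover have "(\<Sum>j<m. zeta j x) = G 0 x - G m x"
    unfolding zeta_def by (rule sum_lessThan_telescope')
  ultimately show ?thesis by (simp add: G_def override_on_def)
qed

lemma zeta_depends_not: "i < j \<Longrightarrow> depends_on (- {i}) (zeta j)"
  by (rule depends_on_mono[OF zeta_depends]) auto

lemma E_zeta_zeta: "i \<noteq> j \<Longrightarrow> E (\<lambda>x. zeta i x * zeta j x) = 0"
proof (induction i j rule: linorder_wlog)
  case (le i j)
  then show ?case by (intro E_zeta_mult zeta_depends_not) auto
next
  case (sym i j)
  then show ?case by (simp add: mult.commute)
qed

lemma E_square_sum:
  assumes "finite J"
  shows "E (\<lambda>x. (\<Sum>i\<in>J. Z i x)\<^sup>2) = (\<Sum>i\<in>J. \<Sum>j\<in>J. E (\<lambda>x. Z i x * Z j x))"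
  by (simp add: power2_eq_square sum_product E_sum)

lemma E_square_sum_orthogonal:
  assumes "finite J" "\<And>i j. i \<in> J \<Longrightarrow> j \<in> J \<Longrightarrow> i < j \<Longrightarrow> E (\<lambda>x. Z i x * Z j x) = 0"
  shows "E (\<lambda>x. (\<Sum>i\<in>J. Z i x)\<^sup>2) = (\<Sum>i\<in>J. E (\<lambda>x. (Z (i::nat) x)\<^sup>2))"
proof -
  have "E (\<lambda>x. Z i x * Z j x) = 0" if "i \<in> J" "j \<in> J" "i \<noteq> j" for i j
    using assms(2)[of i j] assms(2)[of j i] that by (cases i j rule: linorder_cases) (auto simp: mult.commute)
  then have "(\<Sum>j\<in>J. E (\<lambda>x. Z i x * Z j x)) = E (\<lambda>x. (Z i x)\<^sup>2)" if "i \<in> J" for i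
    using that assms(1) by (subst sum.remove[of J i]) (auto simp: power2_eq_square)
  then show ?thesis unfolding E_square_sum[OF assms(1)] by simp
qed

text \<open>
  For families that are uncorrelated at distance more than \<open>k\<close>.  A covariance of close indices is
  at most the mean of the two second moments, and each index is close to at most \<open>2 k + 1\<close> indices.
\<close>

lemma E_square_sum_local:
  assumes "\<And>i j. i < m \<Longrightarrow> j < m \<Longrightarrow> i + k < j \<Longrightarrow> E (\<lambda>x. Z i x * Z j x) = 0"
  shows "E (\<lambda>x. (\<Sum>i<m. Z i x)\<^sup>2) \<le> real (2 * k + 1) * (\<Sum>i<m. E (\<lambda>x. (Z i x)\<^sup>2))"
proof -
  let ?a = "\<lambda>i. E (\<lambda>x. (Z i x)\<^sup>2)"
  let ?c = "\<lambda>i j. if i \<le> j + k \<and> j \<le> i + k then 1 else 0 :: real"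
  have pair: "E (\<lambda>x. Z i x * Z j x) \<le> ?c i j * ?a i / 2 + ?c i j * ?a j / 2" if "i < m" "j < m" for i j
  proof (cases "i \<le> j + k \<and> j \<le> i + k")
    case True
    have "E (\<lambda>x. Z i x * Z j x) \<le> E (\<lambda>x. (Z i x)\<^sup>2 / 2 + (Z j x)\<^sup>2 / 2)"
    proof (rule E_mono)
      fix x show "Z i x * Z j x \<le> (Z i x)\<^sup>2 / 2 + (Z j x)\<^sup>2 / 2"
        using sum_squares_bound[of "Z i x" "Z j x"] by simp
    qed
    also have "\<dots> = ?a i / 2 + ?a j / 2" by simp
    finally show ?thesis using True by simp
  next
    case False
    then show ?thesis using assms[of i j] assms[of j i] that by (auto simp: mult.commute)
  qed
  have count: "(\<Sum>j<m. ?c i j) \<le> real (2 * k + 1)" for i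
  proof -
    have "(\<Sum>j<m. ?c i j) = real (card {j\<in>{..<m}. i \<le> j + k \<and> j \<le> i + k})"
      by (simp add: sum.If_cases Int_def)
    also have "card {j\<in>{..<m}. i \<le> j + k \<and> j \<le> i + k} \<le> card {i - k..i + k}"
      by (rule card_mono) auto
    also have "\<dots> \<le> 2 * k + 1" by simp
    finally show ?thesis by simp
  qed
  have "E (\<lambda>x. (\<Sum>i<m. Z i x)\<^sup>2) \<le> (\<Sum>i<m. \<Sum>j<m. ?c i j * ?a i / 2 + ?c i j * ?a j / 2)"
    unfolding E_square_sum[OF finite_lessThan] by (intro sum_mono pair) auto
  also have "\<dots> = (\<Sum>i<m. \<Sum>j<m. ?c i j * ?a i / 2) + (\<Sum>j<m. \<Sum>i<m. ?c i j * ?a j / 2)"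
    by (simp add: sum.distrib sum.swap[of "\<lambda>i j. ?c i j * ?a j / 2"])
  also have "\<dots> = (\<Sum>i<m. (\<Sum>j<m. ?c i j) * ?a i)"
    by (simp add: sum_distrib_right sum_distrib_left sum.distrib[symmetric] conj_commute mult.commute)
  also have "\<dots> \<le> (\<Sum>i<m. real (2 * k + 1) * ?a i)"
    by (intro sum_mono mult_right_mono count integral_nonneg_AE) auto
  finally show ?thesis by (simp add: sum_distrib_left)
qed

text \<open>
  The variance of \<open>S\<close>.
\<close>

definition V :: real where "V = E (\<lambda>x. (S x - E S)\<^sup>2)"

lemma V_eq: "V = (\<Sum>j<m. E (\<lambda>x. (zeta j x)\<^sup>2))"
  unfolding V_def sum_zeta[symmetric]
  by (rule E_square_sum_orthogonal) (auto intro: E_zeta_zeta)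

text \<open>
  \<open>eta j\<close> is the sum of the differences whose window contains the coordinate \<open>j\<close>; removing it from
  \<open>S\<close> removes the dependence on this coordinate.  \<open>rho i\<close> is the sum of the later differences within
  the window of \<open>zeta i\<close>.
\<close>

definition eta :: "nat \<Rightarrow> (nat \<Rightarrow> 'a) \<Rightarrow> real" where
  "eta j x = (\<Sum>i\<in>{i. i < m \<and> i \<le> j \<and> j \<le> i + k}. zeta i x)"

definition rho :: "nat \<Rightarrow> (nat \<Rightarrow> 'a) \<Rightarrow> real" where
  "rho i x = (\<Sum>j\<in>{j. j < m \<and> i < j \<and> j \<le> i + k}. zeta j x)"

lemma sum_E_eta: "(\<Sum>j<m. E (\<lambda>x. (eta j x)\<^sup>2)) \<le> real (k + 1) * V"
proof -
  have "(\<Sum>j<m. E (\<lambda>x. (eta j x)\<^sup>2)) = (\<Sum>j<m. \<Sum>i\<in>{i\<in>{..<m}. i \<le> j \<and> j \<le> i + k}. E (\<lambda>x. (zeta i x)\<^sup>2))"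
    unfolding eta_def
    by (intro sum.cong refl, subst E_square_sum_orthogonal) (auto intro: E_zeta_zeta)
  also have "\<dots> = (\<Sum>i<m. \<Sum>j\<in>{j\<in>{..<m}. i \<le> j \<and> j \<le> i + k}. E (\<lambda>x. (zeta i x)\<^sup>2))"
    by (rule sum.swap_restrict) auto
  also have "\<dots> \<le> (\<Sum>i<m. real (k + 1) * E (\<lambda>x. (zeta i x)\<^sup>2))"
  proof (rule sum_mono)
    fix i
    have "card {j\<in>{..<m}. i \<le> j \<and> j \<le> i + k} \<le> card {i..i + k}" by (rule card_mono) auto
    then have "real (card {j\<in>{..<m}. i \<le> j \<and> j \<le> i + k}) \<le> real (k + 1)" by simp
    then show "(\<Sum>j\<in>{j\<in>{..<m}. i \<le> j \<and> j \<le> i + k}. E (\<lambda>x. (zeta i x)\<^sup>2)) \<le> real (k + 1) * E (\<lambda>x. (zeta i x)\<^sup>2)"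
      unfolding sum_constant by (intro mult_right_mono integral_nonneg_AE) auto
  qed
  finally show ?thesis by (simp add: V_eq sum_distrib_left)
qed

lemma sum_E_rho: "(\<Sum>i<m. E (\<lambda>x. (rho i x)\<^sup>2)) \<le> real k * V"
proof -
  have "(\<Sum>i<m. E (\<lambda>x. (rho i x)\<^sup>2)) = (\<Sum>i<m. \<Sum>j\<in>{j\<in>{..<m}. i < j \<and> j \<le> i + k}. E (\<lambda>x. (zeta j x)\<^sup>2))"
    unfolding rho_def
    by (intro sum.cong refl, subst E_square_sum_orthogonal) (auto intro: E_zeta_zeta)
  also have "\<dots> = (\<Sum>j<m. \<Sum>i\<in>{i\<in>{..<m}. i < j \<and> j \<le> i + k}. E (\<lambda>x. (zeta j x)\<^sup>2))"
    by (rule sum.swap_restrict) auto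
  also have "\<dots> \<le> (\<Sum>j<m. real k * E (\<lambda>x. (zeta j x)\<^sup>2))"
  proof (rule sum_mono)
    fix j
    have "card {i\<in>{..<m}. i < j \<and> j \<le> i + k} \<le> card {j - k..<j}" by (rule card_mono) auto
    then have "real (card {i\<in>{..<m}. i < j \<and> j \<le> i + k}) \<le> real k" by simp
    then show "(\<Sum>i\<in>{i\<in>{..<m}. i < j \<and> j \<le> i + k}. E (\<lambda>x. (zeta j x)\<^sup>2)) \<le> real k * E (\<lambda>x. (zeta j x)\<^sup>2)"
      unfolding sum_constant by (intro mult_right_mono integral_nonneg_AE) auto
  qed
  finally show ?thesis by (simp add: V_eq sum_distrib_left)
qed

text \<open>
  Each unordered pair of distinct close indices is attributed to the smaller one, so that the factor
  \<open>rho i\<close> does not depend on the coordinate \<open>i\<close>.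
\<close>

lemma sum_zeta_eta: "(\<Sum>j<m. zeta j x * eta j x) = (\<Sum>j<m. (zeta j x)\<^sup>2) + (\<Sum>i<m. zeta i x * rho i x)"
proof -
  have "zeta j x * eta j x = (zeta j x)\<^sup>2 + (\<Sum>i\<in>{i\<in>{..<m}. i < j \<and> j \<le> i + k}. zeta i x * zeta j x)"
    if "j < m" for j
  proof -
    have "{i. i < m \<and> i \<le> j \<and> j \<le> i + k} = insert j {i\<in>{..<m}. i < j \<and> j \<le> i + k}"
      using that by (intro set_eqI) (simp, arith)
    then have "eta j x = zeta j x + (\<Sum>i\<in>{i\<in>{..<m}. i < j \<and> j \<le> i + k}. zeta i x)"
      unfolding eta_def by (simp only:) (subst sum.insert; simp)
    then show ?thesis
      by (simp only: distrib_left power2_eq_square sum_distrib_left mult.commute)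
  qed
  then have "(\<Sum>j<m. zeta j x * eta j x) = (\<Sum>j<m. (zeta j x)\<^sup>2) +
      (\<Sum>j<m. \<Sum>i\<in>{i\<in>{..<m}. i < j \<and> j \<le> i + k}. zeta i x * zeta j x)"
    by (simp add: sum.distrib)
  also have "(\<Sum>j<m. \<Sum>i\<in>{i\<in>{..<m}. i < j \<and> j \<le> i + k}. zeta i x * zeta j x) =
      (\<Sum>i<m. \<Sum>j\<in>{j\<in>{..<m}. i < j \<and> j \<le> i + k}. zeta i x * zeta j x)"
    by (rule sum.swap_restrict) auto
  also have "\<dots> = (\<Sum>i<m. zeta i x * rho i x)"
    unfolding rho_def by (simp add: sum_distrib_left)
  finally show ?thesis .
qed

lemma rho_depends: "i \<le> i' \<Longrightarrow> depends_on (- {i}) (rho i')"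
  unfolding rho_def by (rule depends_on_sum) (auto intro: zeta_depends_not)

lemma zeta_sq_le: "(zeta j x)\<^sup>2 \<le> (real (k + 1))\<^sup>2"
  using power_mono[OF zeta_bound[of j x], of 2] by simp

text \<open>
  The products \<open>zeta i * rho i\<close> are orthogonal, since for \<open>i < j\<close> only the factor \<open>zeta i\<close> depends on
  the coordinate \<open>i\<close>.
\<close>

lemma E_cross_sq: "E (\<lambda>x. (\<Sum>i<m. zeta i x * rho i x)\<^sup>2) \<le> (real (k + 1))\<^sup>2 * real k * V"
proof -
  have "E (\<lambda>x. (\<Sum>i<m. zeta i x * rho i x)\<^sup>2) = (\<Sum>i<m. E (\<lambda>x. (zeta i x * rho i x)\<^sup>2))"
  proof (rule E_square_sum_orthogonal)
    fix i j :: nat assume "i < j"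
    then have "depends_on (- {i}) (\<lambda>x. rho i x * (zeta j x * rho j x))"
      by (intro depends_on_comp2[where u = "(*)"] rho_depends zeta_depends_not) auto
    from E_zeta_mult[OF this] show "E (\<lambda>x. zeta i x * rho i x * (zeta j x * rho j x)) = 0"
      by (simp add: mult.assoc)
  qed simp
  also have "\<dots> \<le> (\<Sum>i<m. (real (k + 1))\<^sup>2 * E (\<lambda>x. (rho i x)\<^sup>2))"
  proof (rule sum_mono)
    fix i
    have "E (\<lambda>x. (zeta i x * rho i x)\<^sup>2) \<le> E (\<lambda>x. (real (k + 1))\<^sup>2 * (rho i x)\<^sup>2)"
      unfolding power_mult_distrib by (intro E_mono mult_right_mono zeta_sq_le) auto
    then show "E (\<lambda>x. (zeta i x * rho i x)\<^sup>2) \<le> (real (k + 1))\<^sup>2 * E (\<lambda>x. (rho i x)\<^sup>2)" by simp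
  qed
  also have "\<dots> = (real (k + 1))\<^sup>2 * (\<Sum>i<m. E (\<lambda>x. (rho i x)\<^sup>2))" by (simp add: sum_distrib_left)
  also have "\<dots> \<le> (real (k + 1))\<^sup>2 * (real k * V)"
    by (intro mult_left_mono sum_E_rho) auto
  finally show ?thesis by (simp add: mult.assoc)
qed

lemma E_diag_sq:
  "E (\<lambda>x. (\<Sum>j<m. (zeta j x)\<^sup>2 - E (\<lambda>x. (zeta j x)\<^sup>2))\<^sup>2) \<le> (real (k + 1))\<^sup>2 * real (2 * k + 1) * V"
proof -
  let ?Z = "\<lambda>j x. (zeta j x)\<^sup>2 - E (\<lambda>x. (zeta j x)\<^sup>2)"
  have dep: "depends_on {j..j + k} (?Z j)" for j
    by (rule depends_on_comp[OF zeta_depends, where u = "\<lambda>z. z\<^sup>2 - E (\<lambda>x. (zeta j x)\<^sup>2)"])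
  have EZ: "E (?Z j) = 0" for j by simp
  have "E (\<lambda>x. (\<Sum>j<m. ?Z j x)\<^sup>2) \<le> real (2 * k + 1) * (\<Sum>j<m. E (\<lambda>x. (?Z j x)\<^sup>2))"
  proof (rule E_square_sum_local)
    fix i j assume "i + k < j"
    then show "E (\<lambda>x. ?Z i x * ?Z j x) = 0"
      by (subst E_mult_disjoint[OF dep dep]) (auto simp: EZ)
  qed
  also have "\<dots> \<le> real (2 * k + 1) * (\<Sum>j<m. (real (k + 1))\<^sup>2 * E (\<lambda>x. (zeta j x)\<^sup>2))"
  proof (intro mult_left_mono sum_mono)
    fix j
    let ?c = "E (\<lambda>x. (zeta j x)\<^sup>2)"
    have "E (\<lambda>x. (?Z j x)\<^sup>2) = E (\<lambda>x. (zeta j x)\<^sup>2 * (zeta j x)\<^sup>2 - 2 * ?c * (zeta j x)\<^sup>2 + ?c\<^sup>2)"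
      by (simp add: power2_eq_square algebra_simps)
    also have "\<dots> = E (\<lambda>x. (zeta j x)\<^sup>2 * (zeta j x)\<^sup>2) - 2 * ?c * ?c + ?c\<^sup>2"
      by (subst Bochner_Integration.integral_add Bochner_Integration.integral_diff; simp?)+
    also have "\<dots> \<le> E (\<lambda>x. (zeta j x)\<^sup>2 * (zeta j x)\<^sup>2)" by (simp add: power2_eq_square)
    also have "\<dots> \<le> E (\<lambda>x. (real (k + 1))\<^sup>2 * (zeta j x)\<^sup>2)"
      by (intro E_mono mult_right_mono zeta_sq_le) auto
    finally show "E (\<lambda>x. (?Z j x)\<^sup>2) \<le> (real (k + 1))\<^sup>2 * ?c" by simp
  qed auto
  also have "\<dots> = (real (k + 1))\<^sup>2 * real (2 * k + 1) * V"
    by (simp add: V_eq sum_distrib_left[symmetric])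
  finally show ?thesis .
qed

lemma V_nonneg: "0 \<le> V" unfolding V_def by (rule integral_nonneg_AE) auto

lemma E_defect: "E (\<lambda>x. \<bar>(\<Sum>j<m. zeta j x * eta j x) - V\<bar>) \<le> 2 * real (k + 1) * sqrt (real (2 * k + 1)) * sqrt V"
proof -
  let ?K = "\<lambda>x. (\<Sum>j<m. zeta j x * eta j x) - V"
  let ?A = "\<lambda>x. \<Sum>j<m. (zeta j x)\<^sup>2 - E (\<lambda>x. (zeta j x)\<^sup>2)" and ?B = "\<lambda>x. \<Sum>i<m. zeta i x * rho i x"
  have K: "?K x = ?A x + ?B x" for x
    unfolding sum_zeta_eta V_eq by (simp add: sum_subtractf)
  have "(E (\<lambda>x. \<bar>?K x\<bar>))\<^sup>2 \<le> E (\<lambda>x. (?K x)\<^sup>2)"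
    using measure_pmf.variance_eq[of Q "\<lambda>x. \<bar>?K x\<bar>"] measure_pmf.variance_positive[of Q "\<lambda>x. \<bar>?K x\<bar>"] by simp
  also have "\<dots> \<le> E (\<lambda>x. 2 * (?A x)\<^sup>2 + 2 * (?B x)\<^sup>2)"
  proof (rule E_mono)
    fix x show "(?K x)\<^sup>2 \<le> 2 * (?A x)\<^sup>2 + 2 * (?B x)\<^sup>2"
      unfolding K using zero_le_power2[of "?A x - ?B x"] by (simp add: power2_sum power2_diff)
  qed
  also have "\<dots> = 2 * E (\<lambda>x. (?A x)\<^sup>2) + 2 * E (\<lambda>x. (?B x)\<^sup>2)" by simp
  also have "\<dots> \<le> 2 * ((real (k + 1))\<^sup>2 * real (2 * k + 1) * V) + 2 * ((real (k + 1))\<^sup>2 * real k * V)"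
    using E_diag_sq E_cross_sq by (intro add_mono mult_left_mono) auto
  also have "\<dots> \<le> 2 * ((real (k + 1))\<^sup>2 * real (2 * k + 1) * V) + 2 * ((real (k + 1))\<^sup>2 * real (2 * k + 1) * V)"
    by (intro add_mono order_refl mult_left_mono mult_right_mono V_nonneg) auto
  also have "\<dots> = (2 * real (k + 1) * sqrt (real (2 * k + 1)) * sqrt V)\<^sup>2"
    using V_nonneg by (simp add: power_mult_distrib del: of_nat_Suc of_nat_add)
  finally show ?thesis by (rule power2_le_imp_le) (use V_nonneg in simp)
qed

text \<open>
  Stein's method applied to the martingale differences.
\<close>

theorem wasserstein_bound:
  assumes \<sigma>: "0 < \<sigma>" "\<sigma>\<^sup>2 = V"
  shows "wasserstein (distr (measure_pmf Q) borel (\<lambda>x. (S x - E S) / \<sigma>)) std_normal_distribution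
    \<le> ereal ((2 * (real k + 1)\<^sup>2 + 4 * (real k + 1) * sqrt (2 * real k + 1)) / \<sigma>)"
  unfolding wasserstein_def
proof (rule SUP_least, simp only: mem_Collect_eq ereal_less_eq(3))
  fix h :: "real \<Rightarrow> real" assume lip: "1-lipschitz_on UNIV h"
  note [measurable] = lipschitz_borel[OF lip]
  let ?W = "\<lambda>x. (S x - E S) / \<sigma>" and ?f = "stein_sol h" and ?f' = "stein_deriv h"
  let ?K = "\<lambda>x. (\<Sum>j<m. zeta j x * eta j x) - V"
  have sqrtV: "sqrt V = \<sigma>" using \<sigma> by (metis less_imp_le real_sqrt_abs abs_of_pos)
  have left: "(\<integral>x. h x \<partial>distr (measure_pmf Q) borel ?W) = E (\<lambda>x. h (?W x))"
    by (subst integral_distr) auto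
  have right: "(\<integral>x. h x \<partial>std_normal_distribution) = gauss_mean h"
    by (rule integral_std_normal_expectation) measurable
  have orth: "E (\<lambda>x. zeta j x * ?f (?W x - eta j x / \<sigma>)) = 0" if "j < m" for j
  proof (rule E_zeta_mult)
    have "?W x - eta j x / \<sigma> = (\<Sum>i\<in>{..<m} - {i. i < m \<and> i \<le> j \<and> j \<le> i + k}. zeta i x) / \<sigma>" for x
      unfolding sum_zeta[symmetric] eta_def diff_divide_distrib[symmetric]
      by (subst sum_diff) auto
    moreover have "depends_on (- {j}) (\<lambda>x. \<Sum>i\<in>{..<m} - {i. i < m \<and> i \<le> j \<and> j \<le> i + k}. zeta i x)"
      by (intro depends_on_sum depends_on_mono[OF zeta_depends]) auto
    ultimately show "depends_on (- {j}) (\<lambda>x. ?f (?W x - eta j x / \<sigma>))"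
      by (simp add: depends_on_comp[where u = "\<lambda>s. ?f (s / \<sigma>)"])
  qed
  have key: "E (\<lambda>x. h (?W x)) - gauss_mean h =
      E (\<lambda>x. ?f' (?W x) - (\<Sum>j<m. zeta j x * (?f (?W x) - ?f (?W x - eta j x / \<sigma>))) / \<sigma>)"
  proof -
    \<comment> \<open>\<open>U\<close> collects the terms in which \<open>W\<close> is stripped of the differences depending on the
        coordinate \<open>j\<close>; they have mean 0 by orthogonality.\<close>
    define U where "U x = (\<Sum>j<m. zeta j x * ?f (?W x - eta j x / \<sigma>))" for x
    let ?R = "\<lambda>x. ?f' (?W x) - (\<Sum>j<m. zeta j x * (?f (?W x) - ?f (?W x - eta j x / \<sigma>))) / \<sigma>"
    have U: "E U = 0" unfolding U_def E_sum using orth by simp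
    have eq: "h (?W x) = gauss_mean h + ?R x - U x / \<sigma>" for x
    proof -
      have "(\<Sum>j<m. zeta j x * (?f (?W x) - ?f (?W x - eta j x / \<sigma>))) = (S x - E S) * ?f (?W x) - U x"
        unfolding U_def sum_zeta[symmetric] by (simp only: right_diff_distrib sum_subtractf sum_distrib_right)
      then have "?R x - U x / \<sigma> = ?f' (?W x) - ?W x * ?f (?W x)"
        by (simp add: diff_divide_distrib left_diff_distrib)
      then show ?thesis by (simp only: stein_deriv_def)
    qed
    have "E (\<lambda>x. h (?W x)) = E (\<lambda>x. gauss_mean h + ?R x - U x / \<sigma>)" by (simp only: eq)
    also have "\<dots> = E (\<lambda>x. gauss_mean h + ?R x) - E (\<lambda>x. U x / \<sigma>)"
      by (rule Bochner_Integration.integral_diff) auto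
    also have "\<dots> = gauss_mean h + E ?R"
      by (subst Bochner_Integration.integral_add) (auto simp: U)
    finally show ?thesis by simp
  qed
  have "\<bar>?f' (?W x) - (\<Sum>j<m. zeta j x * (?f (?W x) - ?f (?W x - eta j x / \<sigma>))) / \<sigma>\<bar>
      \<le> 2 / \<sigma>\<^sup>2 * \<bar>?K x\<bar> + 2 * real (k + 1) / \<sigma> ^ 3 * (\<Sum>j<m. (eta j x)\<^sup>2)" for x
  proof -
    \<comment> \<open>The remainder of the expansion of \<open>f\<close> around \<open>W\<close> to first order.\<close>
    define r where "r j = ?f (?W x) - ?f (?W x - eta j x / \<sigma>) - eta j x / \<sigma> * ?f' (?W x)" for j
    have r: "\<bar>r j\<bar> \<le> 2 * (eta j x / \<sigma>)\<^sup>2" for j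
      using taylor_lipschitz_deriv[OF DERIV_stein_sol[OF lip] stein_deriv_lipschitz[OF lip],
          of "?W x - eta j x / \<sigma>" "?W x"]
      unfolding r_def by (subst abs_minus_cancel[symmetric]) (simp add: algebra_simps)
    define F' R D where "F' = ?f' (?W x)" and "R = (\<Sum>j<m. zeta j x * r j)"
      and "D = (\<Sum>j<m. zeta j x * (?f (?W x) - ?f (?W x - eta j x / \<sigma>)))"
    have "zeta j x * (?f (?W x) - ?f (?W x - eta j x / \<sigma>)) = zeta j x * eta j x * (F' / \<sigma>) + zeta j x * r j" for j
      unfolding r_def F'_def by (simp only: right_diff_distrib) simp
    then have "D = (\<Sum>j<m. zeta j x * eta j x) * (F' / \<sigma>) + R"
      unfolding D_def R_def by (simp only: sum.distrib sum_distrib_right)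
    also have "(\<Sum>j<m. zeta j x * eta j x) = ?K x + \<sigma>\<^sup>2" using \<sigma>(2) by simp
    finally have "F' - D / \<sigma> = - (F' * ?K x / \<sigma>\<^sup>2) - R / \<sigma>"
      using \<sigma>(1) by (simp only: power2_eq_square) (simp add: divide_simps, simp add: algebra_simps)
    then have "\<bar>F' - D / \<sigma>\<bar> \<le> \<bar>F' * ?K x / \<sigma>\<^sup>2\<bar> + \<bar>R\<bar> / \<sigma>"
      using \<sigma>(1) abs_triangle_ineq4[of "- (F' * ?K x / \<sigma>\<^sup>2)" "R / \<sigma>"] by simp
    moreover have "\<bar>F' * ?K x / \<sigma>\<^sup>2\<bar> \<le> 2 * \<bar>?K x\<bar> / \<sigma>\<^sup>2"
      unfolding F'_def abs_mult abs_divide abs_power2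
      by (intro divide_right_mono mult_right_mono stein_bounds(1)[OF lip]) auto
    moreover have "\<bar>R\<bar> / \<sigma> \<le> (\<Sum>j<m. real (k + 1) * (2 * (eta j x / \<sigma>)\<^sup>2)) / \<sigma>"
      unfolding R_def
    proof (intro divide_right_mono order_trans[OF sum_abs] sum_mono)
      fix j
      show "\<bar>zeta j x * r j\<bar> \<le> real (k + 1) * (2 * (eta j x / \<sigma>)\<^sup>2)"
        unfolding abs_mult by (intro mult_mono zeta_bound r) auto
    qed (use \<sigma>(1) in simp)
    moreover have "(\<Sum>j<m. real (k + 1) * (2 * (eta j x / \<sigma>)\<^sup>2)) / \<sigma> =
        2 * real (k + 1) / \<sigma> ^ 3 * (\<Sum>j<m. (eta j x)\<^sup>2)"
      by (simp add: sum_distrib_left sum_divide_distrib power_divide power2_eq_square power3_eq_cube ac_simps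
        del: of_nat_Suc of_nat_add)
    ultimately show ?thesis unfolding F'_def D_def by simp
  qed
  then have "\<bar>E (\<lambda>x. h (?W x)) - gauss_mean h\<bar> \<le>
      E (\<lambda>x. 2 / \<sigma>\<^sup>2 * \<bar>?K x\<bar> + 2 * real (k + 1) / \<sigma> ^ 3 * (\<Sum>j<m. (eta j x)\<^sup>2))"
    unfolding key by (intro order_trans[OF integral_abs_bound] E_mono)
  also have "\<dots> = 2 / \<sigma>\<^sup>2 * E (\<lambda>x. \<bar>?K x\<bar>) + 2 * real (k + 1) / \<sigma> ^ 3 * (\<Sum>j<m. E (\<lambda>x. (eta j x)\<^sup>2))"
    by (subst Bochner_Integration.integral_add) (simp_all add: E_sum)
  also have "\<dots> \<le> 2 / \<sigma>\<^sup>2 * (2 * real (k + 1) * sqrt (real (2 * k + 1)) * sqrt V) +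
      2 * real (k + 1) / \<sigma> ^ 3 * (real (k + 1) * V)"
    using \<sigma>(1) by (intro add_mono mult_left_mono E_defect sum_E_eta) auto
  also have "\<dots> = (2 * (real k + 1)\<^sup>2 + 4 * (real k + 1) * sqrt (2 * real k + 1)) / \<sigma>"
    unfolding sqrtV \<sigma>(2)[symmetric] using \<sigma>(1)
    by (simp add: field_simps power2_eq_square power3_eq_cube)
  finally show "\<bar>(\<integral>x. h x \<partial>distr (measure_pmf Q) borel ?W) - (\<integral>x. h x \<partial>std_normal_distribution)\<bar>
      \<le> (2 * (real k + 1)\<^sup>2 + 4 * (real k + 1) * sqrt (2 * real k + 1)) / \<sigma>"
    unfolding left right .
qed

end

section \<open>Descendants in the tree of an arrangement\<close>

lemma last_filter_nth:
  assumes "i < length xs" "P (xs ! i)" "\<And>x. i < x \<Longrightarrow> x < length xs \<Longrightarrow> \<not> P (xs ! x)"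
  shows "filter P xs \<noteq> [] \<and> last (filter P xs) = xs ! i"
proof -
  have "filter P (drop (Suc i) xs) = []"
    using assms by (auto simp: filter_empty_conv in_set_conv_nth)
  then show ?thesis
    using assms by (subst (1 2) id_take_nth_drop[OF assms(1)]) simp
qed

lemma brt_parent_nth:
  assumes "distinct g" "l < length g"
  shows "brt_parent g (g ! l) =
    (let js = filter (\<lambda>j. j < g ! l) (take l g) in if js = [] then 1 else last js)"
proof -
  have "takeWhile (\<lambda>j. j \<noteq> g ! l) g = take l g"
    using assms by (intro takeWhile_eq_take_P_nth) (auto simp: nth_eq_iff_index_eq)
  then show ?thesis by (simp add: brt_parent_def)
qed

lemma brt_parent_eq_nth:
  assumes g: "distinct g" "l < length g" and "l' < l" "g ! l' < g ! l"
    and "\<And>x. l' < x \<Longrightarrow> x < l \<Longrightarrow> \<not> g ! x < g ! l"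
  shows "brt_parent g (g ! l) = g ! l'"
  using last_filter_nth[of l' "take l g" "\<lambda>j. j < g ! l"] assms
  by (simp add: brt_parent_nth[OF g] Let_def)

lemma brt_parent_cases:
  assumes g: "distinct g" "l < length g"
  obtains (root) "brt_parent g (g ! l) = 1" "\<And>x. x < l \<Longrightarrow> \<not> g ! x < g ! l"
  | (inner) l' where "l' < l" "g ! l' < g ! l" "brt_parent g (g ! l) = g ! l'"
      "\<And>x. l' < x \<Longrightarrow> x < l \<Longrightarrow> \<not> g ! x < g ! l"
proof (cases "\<exists>x<l. g ! x < g ! l")
  case False
  then have "filter (\<lambda>j. j < g ! l) (take l g) = []"
    using g by (auto simp: filter_empty_conv in_set_conv_nth)
  then have "brt_parent g (g ! l) = 1" by (simp add: brt_parent_nth[OF g])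
  with False root show ?thesis by blast
next
  case True
  define l' where "l' = Max {x. x < l \<and> g ! x < g ! l}"
  have fin: "finite {x. x < l \<and> g ! x < g ! l}" by simp
  have "l' \<in> {x. x < l \<and> g ! x < g ! l}"
    unfolding l'_def using True fin by (intro Max_in) auto
  then have l': "l' < l" "g ! l' < g ! l" by simp_all
  have max: "\<not> g ! x < g ! l" if "l' < x" "x < l" for x
  proof
    assume "g ! x < g ! l"
    then have "x \<le> l'" unfolding l'_def using that(2) by (intro Max_ge[OF fin]) simp
    with that(1) show False by simp
  qed
  show ?thesis by (rule inner[OF l' brt_parent_eq_nth[OF g l' max] max])
qed

text \<open>
  The positions \<open>l > j\<close> such that all entries at the positions \<open>j + 1, \<dots>, l\<close> exceed \<open>g ! j\<close>.
\<close>

definition run_above :: "nat list \<Rightarrow> nat \<Rightarrow> nat set" where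
  "run_above g j = {l. j < l \<and> l < length g \<and> (\<forall>x. j < x \<and> x \<le> l \<longrightarrow> g ! j < g ! x)}"

context
  fixes n :: nat and g :: "nat list"
  assumes distinct_g: "distinct g" and set_g: "set g = {2..n}"
begin

lemma brt_of_iff: "(v, w) \<in> brt_of n g \<longleftrightarrow> (\<exists>l<length g. w = g ! l \<and> v = brt_parent g (g ! l))"
  using set_g by (auto simp: brt_of_def set_conv_nth)

lemma nth_eq_iff: "i < length g \<Longrightarrow> j < length g \<Longrightarrow> g ! i = g ! j \<longleftrightarrow> i = j"
  using distinct_g by (simp add: nth_eq_iff_index_eq)

lemma nth_ge_2: "i < length g \<Longrightarrow> 2 \<le> g ! i"
  using set_g by (metis atLeastAtMost_iff nth_mem)

lemma brt_of_step:
  assumes "(g ! j, w) \<in> brt_of n g" "j < length g"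
  obtains l where "w = g ! l" "l < length g" "j < l" "g ! j < g ! l"
    "\<And>x. j < x \<Longrightarrow> x < l \<Longrightarrow> \<not> g ! x < g ! l"
proof -
  obtain l where l: "l < length g" "w = g ! l" "g ! j = brt_parent g (g ! l)"
    using assms(1) unfolding brt_of_iff by auto
  from distinct_g l(1) show ?thesis
  proof (cases rule: brt_parent_cases)
    case root
    then show ?thesis using l nth_ge_2[OF assms(2)] by simp
  next
    case (inner l')
    have "g ! l' = g ! j" by (simp only: l(3) inner(3))
    moreover have "l' < length g" using inner(1) l(1) by simp
    ultimately have l': "l' = j" using nth_eq_iff[of l' j] assms(2) by blast
    show ?thesis by (rule that[OF l(2,1) inner(1,2,4)[unfolded l']])
  qed
qed

text \<open>
  A tree edge from \<open>g ! l\<close> to \<open>g ! l'\<close> means that \<open>l\<close> is the last position before \<open>l'\<close> with a smaller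
  entry, so all entries strictly between are larger than \<open>g ! l'\<close>.
\<close>

lemma descendants_nth:
  assumes j: "j < length g"
  shows "descendants (brt_of n g) (g ! j) = (!) g ` run_above g j"
proof (intro equalityI subsetI)
  fix w assume "w \<in> descendants (brt_of n g) (g ! j)"
  then have "(g ! j, w) \<in> (brt_of n g)\<^sup>+" by (simp add: descendants_def)
  then show "w \<in> (!) g ` run_above g j"
  proof (induction rule: trancl_induct)
    case (base w)
    from base j obtain l where l: "w = g ! l" "l < length g" "j < l" "g ! j < g ! l"
      "\<And>x. j < x \<Longrightarrow> x < l \<Longrightarrow> \<not> g ! x < g ! l"
      by (rule brt_of_step) blast
    have "g ! j < g ! x" if "j < x" "x \<le> l" for x
      using l(4) l(5)[of x] that by (cases "x = l") auto
    then show ?case using l by (auto simp: run_above_def)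
  next
    case (step w u)
    then obtain l where w: "w = g ! l" and l: "j < l" "l < length g"
      "\<And>x. j < x \<Longrightarrow> x \<le> l \<Longrightarrow> g ! j < g ! x" by (auto simp: run_above_def)
    from step(2)[unfolded w] l(2) obtain l' where l': "u = g ! l'" "l' < length g" "l < l'" "g ! l < g ! l'"
      "\<And>x. l < x \<Longrightarrow> x < l' \<Longrightarrow> \<not> g ! x < g ! l'"
      by (rule brt_of_step) blast
    have "g ! j < g ! x" if x: "j < x" "x \<le> l'" for x
      using l(1) l(3)[of x] l(3)[of l] l'(4) l'(5)[of x] x by (cases "x \<le> l"; cases "x = l'") auto
    then show ?case using l' l by (auto simp: run_above_def)
  qed
next
  fix w assume "w \<in> (!) g ` run_above g j"
  then obtain l where "w = g ! l" "l \<in> run_above g j" by auto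
  have "l \<in> run_above g j \<Longrightarrow> (g ! j, g ! l) \<in> (brt_of n g)\<^sup>+" for l
  proof (induction l rule: less_induct)
    case (less l)
    then have l: "j < l" "l < length g" "\<And>x. j < x \<Longrightarrow> x \<le> l \<Longrightarrow> g ! j < g ! x"
      by (auto simp: run_above_def)
    from distinct_g l(2) show ?case
    proof (cases rule: brt_parent_cases)
      case root
      then show ?thesis using root(2)[of j] l(1) l(3)[of l] by simp
    next
      case (inner l')
      have edge: "(g ! l', g ! l) \<in> brt_of n g"
        unfolding brt_of_iff using inner l by auto
      have "j \<le> l'" using inner(4)[of j] l(1) l(3)[of l] by (meson le_refl not_le)
      then consider "l' = j" | "j < l'" by linarith
      then show ?thesis
      proof cases
        case 1
        with edge show ?thesis by auto
      next
        case 2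
        with inner l have "l' \<in> run_above g j" by (auto simp: run_above_def)
        from less.IH[OF inner(1) this] edge show ?thesis by (rule trancl_into_trancl)
      qed
    qed
  qed
  with \<open>w = g ! l\<close> \<open>l \<in> run_above g j\<close> show "w \<in> descendants (brt_of n g) (g ! j)"
    by (simp add: descendants_def)
qed

lemma descendants_root: "descendants (brt_of n g) 1 = set g"
proof (intro equalityI subsetI)
  fix w assume "w \<in> descendants (brt_of n g) 1"
  then have "(1, w) \<in> (brt_of n g)\<^sup>+" by (simp add: descendants_def)
  then show "w \<in> set g"
    by (cases rule: tranclE) (auto simp: brt_of_iff)
next
  fix w assume "w \<in> set g"
  then obtain l where "w = g ! l" "l < length g" by (auto simp: set_conv_nth)
  moreover have "l < length g \<Longrightarrow> (1, g ! l) \<in> (brt_of n g)\<^sup>+" for l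
  proof (induction l rule: less_induct)
    case (less l)
    from distinct_g less.prems show ?case
    proof (cases rule: brt_parent_cases)
      case root
      then show ?thesis using less.prems by (intro r_into_trancl) (auto simp: brt_of_iff)
    next
      case (inner l')
      then have "(g ! l', g ! l) \<in> brt_of n g" using less.prems by (auto simp: brt_of_iff)
      then show ?thesis using less.IH[OF inner(1)] inner(1) less.prems by (meson less_trans trancl_into_trancl)
    qed
  qed
  ultimately show "w \<in> descendants (brt_of n g) 1" by (simp add: descendants_def)
qed

text \<open>
  The run is an interval starting at \<open>j + 1\<close>, so it has at least \<open>k\<close> elements iff it contains
  \<open>j + k\<close>.
\<close>

lemma card_run_above_ge:
  assumes "0 < k"
  shows "k \<le> card (run_above g j) \<longleftrightarrow>
    j + k < length g \<and> (\<forall>x. j < x \<and> x \<le> j + k \<longrightarrow> g ! j < g ! x)" (is "_ \<longleftrightarrow> ?R")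
proof -
  have fin: "finite (run_above g j)"
    by (rule finite_subset[of _ "{..<length g}"]) (auto simp: run_above_def)
  have R: "?R \<longleftrightarrow> j + k \<in> run_above g j" using assms by (auto simp: run_above_def)
  show ?thesis
  proof
    assume k: "k \<le> card (run_above g j)"
    have "j + k \<in> run_above g j"
    proof (rule ccontr)
      assume out: "j + k \<notin> run_above g j"
      have "run_above g j \<subseteq> {j<..<j + k}"
      proof
        fix l assume l: "l \<in> run_above g j"
        have "j + k \<in> run_above g j" if "j + k \<le> l"
          using l that assms by (auto simp: run_above_def)
        with out have "l < j + k" by (meson not_le)
        with l show "l \<in> {j<..<j + k}" by (auto simp: run_above_def)
      qed
      from card_mono[OF _ this] k assms show False by simp
    qed
    then show ?R using R by simp
  next
    assume ?R
    then have "{j<..j + k} \<subseteq> run_above g j" by (auto simp: run_above_def)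
    from card_mono[OF fin this] show "k \<le> card (run_above g j)" by simp
  qed
qed

lemma num_ge_descendants_brt_of:
  assumes "0 < k" "k < n"
  shows "num_ge_descendants n k (brt_of n g) =
    Suc (card {j. j + k < length g \<and> (\<forall>x. j < x \<and> x \<le> j + k \<longrightarrow> g ! j < g ! x)})"
proof -
  let ?T = "brt_of n g"
  let ?J = "{j. j + k < length g \<and> (\<forall>x. j < x \<and> x \<le> j + k \<longrightarrow> g ! j < g ! x)}"
  have inj: "inj_on ((!) g) A" if "A \<subseteq> {..<length g}" for A
    using that nth_eq_iff by (auto simp: inj_on_def)
  have card_desc: "card (descendants ?T (g ! j)) = card (run_above g j)" if "j < length g" for j
    unfolding descendants_nth[OF that] by (rule card_image[OF inj]) (auto simp: run_above_def)
  have len: "length g = n - 1" using distinct_card[OF distinct_g] set_g by simp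
  have "card (set g) = n - 1" using set_g by simp
  then have root: "k \<le> card (descendants ?T 1)" using assms unfolding descendants_root by simp
  have "{v \<in> {1..n}. k \<le> card (descendants ?T v)} = insert 1 ((!) g ` ?J)"
  proof (intro equalityI subsetI)
    fix v assume v: "v \<in> {v \<in> {1..n}. k \<le> card (descendants ?T v)}"
    show "v \<in> insert 1 ((!) g ` ?J)"
    proof (cases "v = 1")
      case False
      with v have "v \<in> set g" using set_g by auto
      then obtain j where j: "j < length g" "v = g ! j" by (auto simp: set_conv_nth)
      with v have "k \<le> card (run_above g j)" by (simp add: card_desc)
      then have "j \<in> ?J" by (simp add: card_run_above_ge[OF assms(1)])
      then show ?thesis using j(2) by (intro insertI2 image_eqI)
    qed simp
  next
    fix v assume "v \<in> insert 1 ((!) g ` ?J)"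
    then consider "v = 1" | j where "v = g ! j" "j \<in> ?J" by blast
    then show "v \<in> {v \<in> {1..n}. k \<le> card (descendants ?T v)}"
    proof cases
      case 1
      then show ?thesis using root assms by simp
    next
      case 2
      then have "j < length g" "k \<le> card (run_above g j)"
        using card_run_above_ge[OF assms(1)] by auto
      moreover from this have "g ! j \<in> {2..n}" using set_g nth_mem by blast
      ultimately show ?thesis using 2 card_desc by simp
    qed
  qed
  moreover have "1 \<notin> (!) g ` ?J"
  proof
    assume "1 \<in> (!) g ` ?J"
    then obtain j where "1 = g ! j" "j < length g" by auto
    then show False using nth_ge_2[of j] by simp
  qed
  moreover have "finite ?J" by (rule finite_subset[of _ "{..<length g}"]) auto
  moreover have "card ((!) g ` ?J) = card ?J" by (rule card_image[OF inj]) auto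
  ultimately show ?thesis by (simp add: num_ge_descendants_def)
qed

end

section \<open>Interleavings of piles as words of pile labels\<close>

lemma map_shuffles: "map f ` shuffles xs ys = shuffles (map f xs) (map f ys)"
proof (induction xs ys rule: shuffles.induct)
  case (3 x xs y ys)
  have "map f ` (#) z ` A = (#) (f z) ` map f ` A" for z A by (simp add: image_image)
  with 3 show ?case by (simp add: image_Un)
qed simp_all

lemma map_interleavings: "map f ` interleavings xss = interleavings (map (map f) xss)"
proof (induction xss)
  case (Cons xs xss)
  have "map f ` interleavings (xs # xss) = (\<Union>ys\<in>map f ` interleavings xss. shuffles (map f xs) ys)"
    by (simp add: image_UN map_shuffles)
  with Cons show ?case by simp
qed simp

lemma sorted_wrt_shuffles:
  assumes "zs \<in> shuffles xs ys" "sorted_wrt R xs" "sorted_wrt R ys"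
    and "\<And>x y. x \<in> set xs \<Longrightarrow> y \<in> set ys \<Longrightarrow> R x y \<and> R y x"
  shows "sorted_wrt R zs"
  using assms
proof (induction zs arbitrary: xs ys)
  case (Cons z zs)
  from Cons.prems(1) consider xs' where "xs = z # xs'" "zs \<in> shuffles xs' ys"
    | ys' where "ys = z # ys'" "zs \<in> shuffles xs ys'"
    by (auto simp: Cons_in_shuffles_iff neq_Nil_conv)
  then show ?case
  proof cases
    case 1
    then show ?thesis using Cons.IH[OF 1(2)] Cons.prems set_shuffles[OF 1(2)] by auto
  next
    case 2
    then show ?thesis using Cons.IH[OF 2(2)] Cons.prems set_shuffles[OF 2(2)] by auto
  qed
qed simp

lemma sorted_wrt_interleavings:
  assumes "zs \<in> interleavings xss" "\<And>xs. xs \<in> set xss \<Longrightarrow> sorted_wrt R xs"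
    and "sorted_wrt (\<lambda>xs ys. \<forall>x\<in>set xs. \<forall>y\<in>set ys. R x y \<and> R y x) xss"
  shows "sorted_wrt R zs"
  using assms
proof (induction xss arbitrary: zs)
  case (Cons xs xss)
  then obtain ys where ys: "ys \<in> interleavings xss" "zs \<in> shuffles xs ys" by auto
  have "set ys = \<Union> (set ` set xss)"
    using mset_eq_setD[OF mset_interleavings[OF ys(1)]] by simp
  then show ?case
    using Cons.prems Cons.IH[OF ys(1)] by (intro sorted_wrt_shuffles[OF ys(2)]) auto
qed simp

lemma map_cut_deck: "cut_deck b (map f deck) = map (map f) (cut_deck b deck)"
  by (induction b arbitrary: deck) (simp_all add: take_map drop_map)

lemma cut_deck_concat: "cut_deck (map length xss) (concat xss) = xss"
  by (induction xss) auto

text \<open>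
  The words of pile labels are the interleavings of constant piles: the pile \<open>s\<close> consists of \<open>b ! s\<close>
  copies of the letter \<open>s\<close>.
\<close>

definition const_piles :: "nat list \<Rightarrow> nat list list" where
  "const_piles b = map (\<lambda>s. replicate (b ! s) s) [0..<length b]"

text \<open>
  The index of the pile containing the card \<open>c\<close> when the deck \<open>2, 3, \<dots>\<close> is cut into piles of sizes
  \<open>b\<close>; the card \<open>c\<close> is at index \<open>c - 2\<close> of the deck.
\<close>

definition pile_of :: "nat list \<Rightarrow> nat \<Rightarrow> nat" where
  "pile_of b c = concat (const_piles b) ! (c - 2)"

lemma map_length_const_piles: "map length (const_piles b) = b"
  by (simp add: const_piles_def comp_def map_nth)

lemma length_concat_const_piles: "length (concat (const_piles b)) = sum_list b"
  by (simp add: length_concat map_length_const_piles)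

lemma sorted_concat_replicate:
  "sorted (ss :: nat list) \<Longrightarrow> sorted (concat (map (\<lambda>s. replicate (c s) s) ss))"
  by (induction ss) (auto simp: sorted_append)

lemma sorted_const_piles: "sorted (concat (const_piles b))"
  unfolding const_piles_def by (rule sorted_concat_replicate) simp

lemma mset_interleavings_replicate:
  assumes "distinct ss" "set w \<subseteq> set ss" "\<And>s. s \<in> set ss \<Longrightarrow> count_list w s = c s"
  shows "w \<in> interleavings (map (\<lambda>s. replicate (c s) s) ss)"
  using assms
proof (induction ss arbitrary: w)
  case (Cons s ss)
  let ?w = "filter (\<lambda>x. \<not> x = s) w"
  have count: "count_list ?w t = count_list w t" if "t \<noteq> s" for t
    using that by (induction w) auto
  have "filter (\<lambda>x. x = s) w = replicate (count_list w s) s"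
    by (induction w) auto
  then have "w \<in> shuffles (replicate (c s) s) ?w"
    using partition_in_shuffles[of w "\<lambda>x. x = s"] Cons.prems(3)[of s] by simp
  moreover have "?w \<in> interleavings (map (\<lambda>s. replicate (c s) s) ss)"
  proof (rule Cons.IH)
    fix t assume "t \<in> set ss"
    then show "count_list ?w t = c t" using count[of t] Cons.prems(1,3) by auto
  qed (use Cons.prems in auto)
  ultimately show ?case by auto
qed simp

lemma count_list_concat_replicate:
  "distinct ss \<Longrightarrow> count_list (concat (map (\<lambda>s. replicate (c s) s) ss)) t = (if t \<in> set ss then c t else 0)"
proof (induction ss)
  case (Cons s ss)
  have "count_list (replicate l s) t = (if t = s then l else 0)" for l
    by (induction l) auto
  with Cons show ?case by auto
qed simp

lemma interleavings_const_piles: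
  "w \<in> interleavings (const_piles b) \<longleftrightarrow> set w \<subseteq> {..<length b} \<and> (\<forall>s<length b. count_list w s = b ! s)"
proof
  assume "w \<in> interleavings (const_piles b)"
  then have m: "mset w = mset (concat (const_piles b))" by (rule mset_interleavings)
  then have "set w = set (concat (const_piles b))" by (rule mset_eq_setD)
  moreover have "count_list w s = count_list (concat (const_piles b)) s" for s
    using m by (metis count_mset)
  ultimately show "set w \<subseteq> {..<length b} \<and> (\<forall>s<length b. count_list w s = b ! s)"
    unfolding const_piles_def by (auto simp: count_list_concat_replicate)
next
  assume "set w \<subseteq> {..<length b} \<and> (\<forall>s<length b. count_list w s = b ! s)"
  then show "w \<in> interleavings (const_piles b)"
    unfolding const_piles_def by (intro mset_interleavings_replicate) auto
qed

lemma map_pile_of_deck: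
  assumes "sum_list b = n - 1" "1 \<le> n"
  shows "map (pile_of b) [2..<n + 1] = concat (const_piles b)"
  using assms by (intro nth_equalityI) (auto simp: length_concat_const_piles pile_of_def simp del: upt_Suc)

lemma map_pile_of_cut_deck:
  assumes "sum_list b = n - 1" "1 \<le> n"
  shows "map (map (pile_of b)) (cut_deck b [2..<n + 1]) = const_piles b"
  using cut_deck_concat[of "const_piles b"]
  unfolding map_cut_deck[symmetric] map_pile_of_deck[OF assms] map_length_const_piles .

text \<open>
  A list is determined by its labels and, for each label, the sublist of the elements carrying it.
\<close>

lemma map_filter_eq_imp_eq:
  assumes "map f xs = map f ys" "\<And>s. filter (\<lambda>x. f x = s) xs = filter (\<lambda>x. f x = s) ys"
  shows "xs = ys"
  using assms
proof (induction xs arbitrary: ys)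
  case (Cons x xs)
  then obtain y ys' where ys: "ys = y # ys'" "f x = f y" "map f xs = map f ys'"
    by (cases ys) auto
  have "x = y" using Cons.prems(2)[of "f x"] ys by simp
  moreover have "filter (\<lambda>x. f x = s) xs = filter (\<lambda>x. f x = s) ys'" for s
    using Cons.prems(2)[of s] ys \<open>x = y\<close> by (auto split: if_splits)
  ultimately show ?case using Cons.IH[OF ys(3)] ys(1) by simp
qed simp

context
  fixes n :: nat and b :: "nat list"
  assumes sum_b: "sum_list b = n - 1" and n: "1 \<le> n"
begin

text \<open>
  Cards of the same pile keep their order.
\<close>

lemma interleavings_cut_deck_sorted:
  assumes "g \<in> interleavings (cut_deck b [2..<n + 1])"
  shows "sorted_wrt (\<lambda>c c'. pile_of b c = pile_of b c' \<longrightarrow> c < c') g"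
  using assms
proof (rule sorted_wrt_interleavings)
  let ?R = "\<lambda>c c'. pile_of b c = pile_of b c' \<longrightarrow> c < c'"
  let ?piles = "cut_deck b [2..<n + 1]"
  note piles = map_pile_of_cut_deck[OF sum_b n]
  have len: "length ?piles = length b"
    using arg_cong[OF piles, of length] by (simp add: const_piles_def)
  have pile: "pile_of b x = s" if "s < length b" "x \<in> set (?piles ! s)" for s x
  proof -
    have "map (pile_of b) (?piles ! s) = replicate (b ! s) s"
      using that(1) len arg_cong[OF piles, of "\<lambda>xss. xss ! s"] by (simp add: const_piles_def)
    then have "set (map (pile_of b) (?piles ! s)) \<subseteq> {s}" by (auto simp: set_replicate_conv_if)
    then show ?thesis using that(2) by auto
  qed
  show "sorted_wrt ?R xs" if "xs \<in> set ?piles" for xs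
  proof -
    have "sorted_wrt (<) xs" if "xs \<in> set (cut_deck b deck)" "sorted_wrt (<) deck" for xs and deck :: "nat list"
      using that by (induction b arbitrary: deck) (auto intro: sorted_wrt_take sorted_wrt_drop)
    from this[OF that sorted_wrt_upt] show ?thesis by (rule sorted_wrt_mono_rel[rotated]) simp
  qed
  show "sorted_wrt (\<lambda>xs ys. \<forall>x\<in>set xs. \<forall>y\<in>set ys. ?R x y \<and> ?R y x) ?piles"
    unfolding sorted_wrt_iff_nth_less
  proof (intro allI impI ballI)
    fix i j x y assume ij: "i < j" "j < length ?piles" and x: "x \<in> set (?piles ! i)" and y: "y \<in> set (?piles ! j)"
    have "pile_of b x = i" by (rule pile[OF _ x]) (use ij len in linarith)
    moreover have "pile_of b y = j" by (rule pile[OF _ y]) (use ij len in linarith)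
    ultimately show "?R x y \<and> ?R y x" using \<open>i < j\<close> by simp
  qed
qed

lemma mset_interleavings_cut_deck:
  assumes "g \<in> interleavings (cut_deck b [2..<n + 1])"
  shows "mset g = mset [2..<n + 1]"
  using mset_interleavings[OF assms] concat_cut_deck[of b "[2..<n + 1]"] sum_b by (simp del: upt_Suc)

text \<open>
  Within a pile the cards appear in increasing order, so the labels determine the arrangement.
\<close>

lemma inj_on_map_pile_of: "inj_on (map (pile_of b)) (interleavings (cut_deck b [2..<n + 1]))"
proof (rule inj_onI)
  fix g g' assume g: "g \<in> interleavings (cut_deck b [2..<n + 1])" "g' \<in> interleavings (cut_deck b [2..<n + 1])"
    and eq: "map (pile_of b) g = map (pile_of b) g'"
  have mono: "sorted_wrt (<) (filter (\<lambda>x. pile_of b x = s) h)"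
    if "h \<in> interleavings (cut_deck b [2..<n + 1])" for s h
  proof -
    have "sorted_wrt (\<lambda>c c'. pile_of b c = pile_of b c' \<longrightarrow> c < c') (filter (\<lambda>x. pile_of b x = s) h)"
      by (rule sorted_wrt_filter[OF interleavings_cut_deck_sorted[OF that]])
    then show ?thesis by (rule sorted_wrt_mono_rel[rotated]) auto
  qed
  have "set g = set g'"
    using mset_interleavings_cut_deck[OF g(1)] mset_interleavings_cut_deck[OF g(2)]
    by (metis mset_eq_setD)
  then have "filter (\<lambda>x. pile_of b x = s) g = filter (\<lambda>x. pile_of b x = s) g'" for s
    using mono[OF g(1), of s] mono[OF g(2), of s]
    by (intro strict_sorted_equal) auto
  with eq show "g = g'" by (rule map_filter_eq_imp_eq)
qed

lemma image_map_pile_of: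
  "map (pile_of b) ` interleavings (cut_deck b [2..<n + 1]) = interleavings (const_piles b)"
  by (simp only: map_interleavings map_pile_of_cut_deck[OF sum_b n])

text \<open>
  Comparing two cards amounts to comparing their piles weakly: a tie means that the earlier card is
  the smaller one.
\<close>

lemma nth_less_iff_pile_of_le:
  assumes "g \<in> interleavings (cut_deck b [2..<n + 1])" "i < j" "j < length g"
  shows "g ! i < g ! j \<longleftrightarrow> pile_of b (g ! i) \<le> pile_of b (g ! j)"
proof -
  have set_g: "set g = {2..<n + 1}"
    using mset_eq_setD[OF mset_interleavings_cut_deck[OF assms(1)]] by (simp del: upt_Suc)
  have mem: "g ! i \<in> {2..<n + 1}" "g ! j \<in> {2..<n + 1}"
    using assms(2,3) set_g[symmetric] by auto
  have "pile_of b c \<le> pile_of b c'" if "c \<le> c'" "c' \<in> {2..<n + 1}" for c c'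
    unfolding pile_of_def using that sum_b length_concat_const_piles
    by (intro sorted_nth_mono[OF sorted_const_piles]) auto
  moreover have "pile_of b (g ! i) = pile_of b (g ! j) \<longrightarrow> g ! i < g ! j"
    using sorted_wrt_nth_less[OF interleavings_cut_deck_sorted[OF assms(1)] assms(2,3)] .
  ultimately show ?thesis
    using mem by (metis le_neq_implies_less linorder_not_less nat_less_le)
qed

end

section \<open>The law of the number of vertices with many descendants\<close>

text \<open>
  The law \<open>p\<close> on the labels \<open>0, \<dots>, length p - 1\<close>.
\<close>

definition label_pmf :: "real list \<Rightarrow> nat pmf" where
  "label_pmf p = embed_pmf (\<lambda>s. if s < length p then p ! s else 0)"

text \<open>
  The law of a word of \<open>m\<close> independent labels.
\<close>

definition word_pmf :: "nat \<Rightarrow> real list \<Rightarrow> nat list pmf" where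
  "word_pmf m p = map_pmf (\<lambda>x. map x [0..<m]) (Pi_pmf {..<m} 0 (\<lambda>_. label_pmf p))"

lemma prod_power_count_list:
  fixes q :: "nat \<Rightarrow> real"
  shows "set w \<subseteq> {..<a} \<Longrightarrow> (\<Prod>s<a. q s ^ count_list w s) = prod_list (map q w)"
proof (induction w)
  case (Cons t w)
  have "(\<Prod>s<a. q s ^ count_list (t # w) s) = (\<Prod>s<a. (if s = t then q s else 1) * q s ^ count_list w s)"
    by (rule prod.cong) auto
  also have "\<dots> = q t * (\<Prod>s<a. q s ^ count_list w s)"
    using Cons.prems by (simp add: prod.distrib)
  finally show ?case using Cons by simp
qed simp

context
  fixes p :: "real list"
  assumes p_nonneg: "\<forall>s<length p. 0 \<le> p ! s" and p_sum: "(\<Sum>s<length p. p ! s) = 1"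
begin

lemma pmf_label_pmf: "pmf (label_pmf p) s = (if s < length p then p ! s else 0)"
  unfolding label_pmf_def
proof (rule pmf_embed_pmf)
  show "0 \<le> (if s < length p then p ! s else 0)" for s using p_nonneg by simp
  have "(\<integral>\<^sup>+ s. ennreal (if s < length p then p ! s else 0) \<partial>count_space UNIV) = (\<Sum>s<length p. ennreal (p ! s))"
    by (subst nn_integral_count_space'[of "{..<length p}"]) (auto intro: sum.cong)
  also have "\<dots> = 1" using p_nonneg by (subst sum_ennreal) (auto simp: p_sum)
  finally show "(\<integral>\<^sup>+ s. ennreal (if s < length p then p ! s else 0) \<partial>count_space UNIV) = 1" .
qed

lemma finite_set_label_pmf: "finite (set_pmf (label_pmf p))"
  by (rule finite_subset[of _ "{..<length p}"]) (auto simp: set_pmf_eq pmf_label_pmf split: if_splits)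

lemma pmf_word_pmf:
  "pmf (word_pmf m p) w =
     (if length w = m \<and> set w \<subseteq> {..<length p} then \<Prod>s<length p. (p ! s) ^ count_list w s else 0)"
proof (cases "length w = m")
  case True
  define x where "x = (\<lambda>i. if i < m then w ! i else 0)"
  have w: "w = map x [0..<m]" using True by (intro nth_equalityI) (auto simp: x_def)
  have "pmf (word_pmf m p) w = pmf (Pi_pmf {..<m} 0 (\<lambda>_. label_pmf p)) x"
  proof -
    let ?M = "Pi_pmf {..<m} 0 (\<lambda>_. label_pmf p)"
    have "y \<in> (\<lambda>x. map x [0..<m]) -` {w} \<longleftrightarrow> y \<in> {x}" if "y \<in> set_pmf ?M" for y
    proof -
      have out: "y i = 0" if "\<not> i < m" for i
        using set_Pi_pmf_subset[of "{..<m}" 0 "\<lambda>_. label_pmf p"] that \<open>y \<in> set_pmf ?M\<close> by auto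
      have "map y [0..<m] = w \<longleftrightarrow> (\<forall>i<m. y i = x i)" unfolding w by auto
      also have "\<dots> \<longleftrightarrow> y = x" using out by (auto simp: fun_eq_iff x_def)
      finally show ?thesis by simp
    qed
    then show ?thesis
      unfolding word_pmf_def pmf_map by (subst measure_pmf_single[symmetric])
        (intro measure_pmf.finite_measure_eq_AE AE_pmfI, auto)
  qed
  also have "\<dots> = (\<Prod>i<m. pmf (label_pmf p) (w ! i))"
    by (subst pmf_Pi') (auto simp: x_def)
  also have "\<dots> = prod_list (map (pmf (label_pmf p)) w)"
    using True by (simp add: prod.list_conv_set_nth atLeast0LessThan)
  also have "\<dots> = (if set w \<subseteq> {..<length p} then \<Prod>s<length p. (p ! s) ^ count_list w s else 0)"
  proof (cases "set w \<subseteq> {..<length p}")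
    case True
    then show ?thesis
      by (simp add: prod_power_count_list[symmetric] pmf_label_pmf)
  next
    case False
    then have "0 \<in> set (map (pmf (label_pmf p)) w)" by (auto simp: pmf_label_pmf)
    then have "prod_list (map (pmf (label_pmf p)) w) = 0" by (simp only: prod_list_zero_iff)
    with False show ?thesis by simp
  qed
  finally show ?thesis using True by simp
next
  case False
  then have "w \<notin> set_pmf (word_pmf m p)" by (auto simp: word_pmf_def)
  with False show ?thesis by (simp add: pmf_eq_0_set_pmf)
qed

lemma card_interleavings_const_piles:
  "card (interleavings (const_piles b)) * (\<Prod>s<length b. fact (b ! s)) = (fact (sum_list b) :: nat)"
proof -
  have "card (interleavings (const_piles b)) = card (interleavings (cut_deck b [2..<Suc (sum_list b) + 1]))"
    using card_image[OF inj_on_map_pile_of[of b "Suc (sum_list b)"]] image_map_pile_of[of b "Suc (sum_list b)"]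
    by simp
  moreover have "(\<Prod>s<length b. fact (b ! s)) = (\<Prod>c\<leftarrow>b. fact c :: nat)"
    by (simp add: prod.list_conv_set_nth atLeast0LessThan)
  ultimately show ?thesis
    using card_interleavings_cut_deck[of "[2..<Suc (sum_list b) + 1]" b] by (simp del: upt_Suc)
qed

text \<open>
  The letter counts of an independent word are multinomial, and given the counts the word is uniform:
  the multinomial weight is the number of words times the probability of a single one.
\<close>

lemma word_pmf_eq_bind:
  "word_pmf m p = bind_pmf (multinomial_pmf m p) (\<lambda>b. pmf_of_set (interleavings (const_piles b)))"
proof (rule pmf_eqI)
  fix w
  let ?C = "compositions (length p) m"
  define c where "c = map (count_list w) [0..<length p]"
  have c: "length c = length p" "\<And>s. s < length p \<Longrightarrow> c ! s = count_list w s" by (simp_all add: c_def)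
  have "\<forall>x\<in>set p. 0 \<le> x" using p_nonneg by (auto simp: in_set_conv_nth)
  moreover have "sum_list p = 1" using p_sum by (simp add: sum_list_sum_nth atLeast0LessThan)
  ultimately have pmf_mult: "pmf (multinomial_pmf m p) b = (if b \<in> ?C then multinomial_weight m p b else 0)" for b
    by (rule pmf_multinomial_pmf)
  have "pmf (bind_pmf (multinomial_pmf m p) (\<lambda>b. pmf_of_set (interleavings (const_piles b)))) w =
      (\<Sum>b\<in>?C. pmf (pmf_of_set (interleavings (const_piles b))) w * pmf (multinomial_pmf m p) b)"
    unfolding pmf_bind
    by (rule integral_measure_pmf_real[OF finite_compositions])
       (auto simp: set_pmf_eq pmf_mult split: if_splits)
  also have "\<dots> = (\<Sum>b\<in>?C. if b = c \<and> set w \<subseteq> {..<length p} then \<Prod>s<length p. (p ! s) ^ count_list w s else 0)"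
  proof (rule sum.cong[OF refl])
    fix b assume b: "b \<in> ?C"
    then have len: "length b = length p" and sum: "sum_list b = m" by (auto simp: compositions_def)
    have iff: "w \<in> interleavings (const_piles b) \<longleftrightarrow> b = c \<and> set w \<subseteq> {..<length p}"
    proof -
      have "b = c \<longleftrightarrow> (\<forall>s<length p. count_list w s = b ! s)"
        unfolding list_eq_iff_nth_eq using len c by auto
      then show ?thesis unfolding interleavings_const_piles len by auto
    qed
    have "real (card (interleavings (const_piles b))) * (\<Prod>s<length p. fact (b ! s)) = fact m"
      using arg_cong[OF card_interleavings_const_piles[of b], of real] by (simp add: len sum)
    then have "multinomial_weight m p b =
        real (card (interleavings (const_piles b))) * (\<Prod>s<length p. (p ! s) ^ (b ! s))"
      unfolding multinomial_weight_def by (simp add: field_simps)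
    moreover have "card (interleavings (const_piles b)) \<noteq> 0"
      by (simp add: card_eq_0_iff finite_interleavings interleavings_nonempty)
    ultimately have "pmf (pmf_of_set (interleavings (const_piles b))) w * pmf (multinomial_pmf m p) b =
        (if w \<in> interleavings (const_piles b) then \<Prod>s<length p. (p ! s) ^ (b ! s) else 0)"
      using b by (simp add: pmf_of_set[OF interleavings_nonempty finite_interleavings] pmf_mult)
    also have "\<dots> = (if b = c \<and> set w \<subseteq> {..<length p} then \<Prod>s<length p. (p ! s) ^ count_list w s else 0)"
      unfolding iff using c(2) by (intro if_cong refl prod.cong) auto
    finally show "pmf (pmf_of_set (interleavings (const_piles b))) w * pmf (multinomial_pmf m p) b = \<dots>" .
  qed
  also have "\<dots> = (if c \<in> ?C \<and> set w \<subseteq> {..<length p} then \<Prod>s<length p. (p ! s) ^ count_list w s else 0)"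
    by (auto simp: finite_compositions sum.If_cases)
  also have "\<dots> = pmf (word_pmf m p) w"
  proof -
    have "c \<in> ?C \<longleftrightarrow> length w = m" if "set w \<subseteq> {..<length p}"
    proof -
      have "sum_list c = length w"
        using sum_count_set[OF that] by (simp add: c_def interv_sum_list_conv_sum_set_nat atLeast0LessThan)
      then show ?thesis by (simp add: compositions_def c)
    qed
    then show ?thesis by (auto simp: pmf_word_pmf)
  qed
  finally show "pmf (word_pmf m p) w =
    pmf (bind_pmf (multinomial_pmf m p) (\<lambda>b. pmf_of_set (interleavings (const_piles b)))) w" ..
qed

text \<open>
  A statistic \<open>F\<close> of the shuffle that is a function \<open>H\<close> of the word of pile labels has the law of \<open>H\<close>
  at an independent word.
\<close>

lemma map_riffle_pmf:
  assumes n: "1 \<le> n"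
    and eq: "\<And>b g. b \<in> compositions (length p) (n - 1) \<Longrightarrow> g \<in> interleavings (cut_deck b [2..<n + 1]) \<Longrightarrow>
      F g = H (map (pile_of b) g)"
  shows "map_pmf F (riffle_pmf n p) = map_pmf H (word_pmf (n - 1) p)"
  unfolding riffle_pmf_def word_pmf_eq_bind map_bind_pmf
proof (rule bind_pmf_cong[OF refl])
  fix b assume b: "b \<in> set_pmf (multinomial_pmf (n - 1) p)"
  have "\<forall>x\<in>set p. 0 \<le> x" using p_nonneg by (auto simp: in_set_conv_nth)
  moreover have "sum_list p = 1" using p_sum by (simp add: sum_list_sum_nth atLeast0LessThan)
  ultimately have C: "b \<in> compositions (length p) (n - 1)"
    using b by (auto simp: set_pmf_eq pmf_multinomial_pmf split: if_splits)
  then have sum: "sum_list b = n - 1" by (simp add: compositions_def)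
  let ?I = "interleavings (cut_deck b [2..<n + 1])"
  have "map_pmf F (pmf_of_set ?I) = map_pmf H (map_pmf (map (pile_of b)) (pmf_of_set ?I))"
    unfolding map_pmf_comp
    by (rule map_pmf_cong[OF refl])
       (simp add: eq[OF C] set_pmf_of_set[OF interleavings_nonempty finite_interleavings])
  also have "map_pmf (map (pile_of b)) (pmf_of_set ?I) = pmf_of_set (interleavings (const_piles b))"
    unfolding image_map_pile_of[OF sum n, symmetric]
    by (rule map_pmf_of_set_inj[OF inj_on_map_pile_of[OF sum n] interleavings_nonempty finite_interleavings])
  finally show "map_pmf F (pmf_of_set ?I) = map_pmf H (pmf_of_set (interleavings (const_piles b)))" .
qed

end

text \<open>
  The indicator that the coordinate \<open>i\<close> is a weak minimum of its window \<open>i, \<dots>, i + k\<close>.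
\<close>

definition window_min :: "nat \<Rightarrow> nat \<Rightarrow> (nat \<Rightarrow> nat) \<Rightarrow> real" where
  "window_min k i x = of_bool (\<forall>j\<in>{i..i + k}. x i \<le> x j)"

theorem law_num_ge_descendants:
  fixes p :: "real list"
  assumes p: "\<forall>s<length p. 0 \<le> p ! s" "(\<Sum>s<length p. p ! s) = 1" and k: "0 < k" "k < n"
  shows "map_pmf (\<lambda>T. real (num_ge_descendants n k T)) (brt_pmf n p) =
    map_pmf (\<lambda>x. 1 + (\<Sum>i<n - 1 - k. window_min k i x)) (Pi_pmf {..<n - 1} 0 (\<lambda>_. label_pmf p))"
proof -
  define F H :: "nat list \<Rightarrow> real" where "F = (\<lambda>g. real (num_ge_descendants n k (brt_of n g)))"
    and "H = (\<lambda>w. 1 + real (card {j. j + k < length w \<and> (\<forall>x. j < x \<and> x \<le> j + k \<longrightarrow> w ! j \<le> w ! x)}))"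
  have n: "1 \<le> n" using k by simp
  have "map_pmf F (riffle_pmf n p) = map_pmf H (word_pmf (n - 1) p)"
  proof (rule map_riffle_pmf[OF p n])
    fix b g assume b: "b \<in> compositions (length p) (n - 1)" and g: "g \<in> interleavings (cut_deck b [2..<n + 1])"
    then have sum: "sum_list b = n - 1" by (simp add: compositions_def)
    note m = mset_interleavings_cut_deck[OF sum n g]
    have "distinct g" using mset_eq_imp_distinct_iff[OF m] by simp
    moreover have "set g = {2..n}" using mset_eq_setD[OF m] by (simp add: atLeastLessThanSuc_atLeastAtMost del: upt_Suc)
    ultimately have "F g = 1 + real (card {j. j + k < length g \<and> (\<forall>x. j < x \<and> x \<le> j + k \<longrightarrow> g ! j < g ! x)})"
      unfolding F_def by (simp add: num_ge_descendants_brt_of[OF _ _ k])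
    also have "{j. j + k < length g \<and> (\<forall>x. j < x \<and> x \<le> j + k \<longrightarrow> g ! j < g ! x)} =
        {j. j + k < length g \<and> (\<forall>x. j < x \<and> x \<le> j + k \<longrightarrow> map (pile_of b) g ! j \<le> map (pile_of b) g ! x)}"
      by (intro Collect_cong conj_cong refl all_cong) (auto simp: nth_less_iff_pile_of_le[OF sum n g])
    finally show "F g = H (map (pile_of b) g)" by (simp add: H_def)
  qed
  moreover have "H (map x [0..<n - 1]) = 1 + (\<Sum>i<n - 1 - k. window_min k i x)" for x
  proof -
    have "{j. j + k < n - 1 \<and> (\<forall>i. j < i \<and> i \<le> j + k \<longrightarrow> map x [0..<n - 1] ! j \<le> map x [0..<n - 1] ! i)} =
        {j\<in>{..<n - 1 - k}. \<forall>i\<in>{j..j + k}. x j \<le> x i}"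
    proof (rule set_eqI)
      fix j
      show "j \<in> {j. j + k < n - 1 \<and> (\<forall>i. j < i \<and> i \<le> j + k \<longrightarrow> map x [0..<n - 1] ! j \<le> map x [0..<n - 1] ! i)} \<longleftrightarrow>
          j \<in> {j\<in>{..<n - 1 - k}. \<forall>i\<in>{j..j + k}. x j \<le> x i}"
      proof (cases "j + k < n - 1")
        case True
        then have "map x [0..<n - 1] ! i = x i" if "i \<le> j + k" for i using that by simp
        moreover have "(\<forall>i. j < i \<and> i \<le> j + k \<longrightarrow> x j \<le> x i) \<longleftrightarrow> (\<forall>i\<in>{j..j + k}. x j \<le> x i)"
          by (metis atLeastAtMost_iff le_neq_implies_less less_imp_le order_refl)
        ultimately show ?thesis using True by (auto simp: less_diff_conv)
      qed (auto simp: less_diff_conv)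
    qed
    then show ?thesis
      by (simp add: H_def window_min_def of_bool_def sum.If_cases Int_def)
  qed
  ultimately show ?thesis
    by (simp add: brt_pmf_def word_pmf_def map_pmf_comp F_def)
qed

text \<open>
  The square root terms are compared by \<open>k + 1 \<le> 2/3 (2 k + 1)\<close> and \<open>64/9 \<le> 28/\<pi>\<close>.
\<close>

lemma wasserstein_constant_le:
  fixes k :: nat
  assumes "0 < k"
  shows "2 * (real k + 1)\<^sup>2 + 4 * (real k + 1) * sqrt (2 * real k + 1) \<le>
    (2 * real k + 1) * ((2 * real k + 1) + sqrt 28 * sqrt (2 * real k + 1) / sqrt pi)"
proof -
  let ?D = "2 * real k + 1"
  have k: "1 \<le> real k" using assms by simp
  have "2 * (real k + 1)\<^sup>2 \<le> ?D * ?D"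
    using mult_mono[OF k k] by (simp add: power2_eq_square algebra_simps)
  moreover have "4 * (real k + 1) * sqrt ?D \<le> ?D * (sqrt 28 / sqrt pi * sqrt ?D)"
  proof -
    have "8 / 3 \<le> sqrt (28 / pi)"
    proof (rule real_le_rsqrt)
      have "pi * (64 / 9) \<le> 28" using pi_approx by simp
      then show "(8 / 3)\<^sup>2 \<le> 28 / pi" by (simp add: power2_eq_square field_simps)
    qed
    then have "8 / 3 \<le> sqrt 28 / sqrt pi" by (simp add: real_sqrt_divide)
    have "4 * (real k + 1) \<le> ?D * (8 / 3)" using k by simp
    also have "\<dots> \<le> ?D * (sqrt 28 / sqrt pi)"
      using \<open>8 / 3 \<le> sqrt 28 / sqrt pi\<close> by (intro mult_left_mono) auto
    finally show ?thesis using mult_right_mono[of _ _ "sqrt ?D"] by (fastforce simp: mult.assoc)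
  qed
  ultimately show ?thesis by (simp add: distrib_left)
qed

theorem theorem4p3:
  fixes a n k :: nat and p :: "real list" and Y :: "rtree \<Rightarrow> real" and \<mu> \<sigma> :: real
  assumes "a \<ge> 1" and "length p = a" and "\<forall>s<a. p ! s > 0" and "(\<Sum>s<a. p ! s) = 1"
    and "n \<ge> 2" and "k \<le> n - 1"
    and "Y = (\<lambda>T. real (num_ge_descendants n k T))"
    and "\<mu> = measure_pmf.expectation (brt_pmf n p) Y"
    and "\<sigma>\<^sup>2 = measure_pmf.variance (brt_pmf n p) Y" and "\<sigma> > 0"
  shows "wasserstein (distr (measure_pmf (brt_pmf n p)) borel (\<lambda>T. (Y T - \<mu>) / \<sigma>))
           std_normal_distribution
         \<le> ereal ((2 * real k + 1) / \<sigma> *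
              ((2 * real k + 1) + sqrt 28 * sqrt (2 * real k + 1) / sqrt pi))"
proof -
  \<comment> \<open>For \<open>k = 0\<close> every vertex counts, so the variance vanishes.\<close>
  have k: "0 < k"
  proof (rule ccontr)
    assume "\<not> 0 < k"
    then have "{v \<in> {1..n}. k \<le> card (descendants T v)} = {1..n}" for T by auto
    then have "Y = (\<lambda>T. real n)" unfolding assms(7) num_ge_descendants_def by (simp only: card_atLeastAtMost) simp
    then have "\<sigma>\<^sup>2 = 0" using assms(9) by simp
    with \<open>\<sigma> > 0\<close> show False by simp
  qed
  have "k < n" using assms(5,6) by simp
  interpret local_sum "n - 1" "n - 1 - k" k 0 "\<lambda>_. label_pmf p" "window_min k"
  proof
    show "finite (set_pmf (label_pmf p))"
      by (rule finite_set_label_pmf) (use assms(2,3,4) in \<open>auto intro: less_imp_le\<close>)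
    show "depends_on {i..i + k} (window_min k i)" for i
      unfolding depends_on_def window_min_def by simp
    show "0 \<le> window_min k i x \<and> window_min k i x \<le> 1" for i x
      by (simp add: window_min_def)
    show "n - 1 - k + k \<le> n - 1" using assms(6) by simp
  qed
  have law: "map_pmf Y (brt_pmf n p) = map_pmf (\<lambda>x. 1 + S x) Q"
    unfolding assms(7) S_def Q_def
    by (rule law_num_ge_descendants) (use assms(2,3,4) k \<open>k < n\<close> in \<open>auto intro: less_imp_le\<close>)
  have transfer: "measure_pmf.expectation (brt_pmf n p) (\<lambda>T. u (Y T)) = E (\<lambda>x. u (1 + S x))" for u :: "real \<Rightarrow> real"
    using arg_cong[OF law, of "\<lambda>M. measure_pmf.expectation M u"] by simp
  have \<mu>: "\<mu> = 1 + E S"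
    unfolding assms(8) transfer[of "\<lambda>y. y"]
    by (subst Bochner_Integration.integral_add[OF integrable_Q integrable_Q]) simp
  have "\<sigma>\<^sup>2 = V"
    using transfer[of "\<lambda>y. (y - \<mu>)\<^sup>2"] unfolding assms(9) assms(8)[symmetric] V_def by (simp add: \<mu>)
  have distr: "distr (measure_pmf M) borel (\<lambda>T. u (f T)) = distr (measure_pmf (map_pmf f M)) borel u"
    for M :: "'b pmf" and f :: "'b \<Rightarrow> real" and u :: "real \<Rightarrow> real"
    by (simp add: map_pmf_rep_eq distr_distr comp_def)
  have "distr (measure_pmf (brt_pmf n p)) borel (\<lambda>T. (Y T - \<mu>) / \<sigma>) =
      distr (measure_pmf Q) borel (\<lambda>x. (S x - E S) / \<sigma>)"
    using distr[of "brt_pmf n p" "\<lambda>y. (y - \<mu>) / \<sigma>" Y] distr[of Q "\<lambda>y. (y - \<mu>) / \<sigma>" "\<lambda>x. 1 + S x"] law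
    by (simp add: \<mu>)
  then have "wasserstein (distr (measure_pmf (brt_pmf n p)) borel (\<lambda>T. (Y T - \<mu>) / \<sigma>)) std_normal_distribution
      \<le> ereal ((2 * (real k + 1)\<^sup>2 + 4 * (real k + 1) * sqrt (2 * real k + 1)) / \<sigma>)"
    using wasserstein_bound[OF \<open>\<sigma> > 0\<close> \<open>\<sigma>\<^sup>2 = V\<close>] by simp
  also have "\<dots> \<le> ereal ((2 * real k + 1) * ((2 * real k + 1) + sqrt 28 * sqrt (2 * real k + 1) / sqrt pi) / \<sigma>)"
    using wasserstein_constant_le[OF k] \<open>\<sigma> > 0\<close> by (simp add: divide_right_mono)
  finally show ?thesis by simp
qed

end
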